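(* Let $0\le\alpha<1$. Assume $T\in B(X)$ has SVEP and $x\in X$ satisfies $\|e^{tT}x\|\le C_x(1+|t|^\alpha)$ for all $t\in\mathbb{R}$ and some $C_x>0$. Then $$\|Tx\|\le C_x\left[r_T(x)+C(\alpha)\,r_T(x)^{1-\alpha}\right],\qquad C(\alpha)=\left(\frac{2}{\pi}\right)^{2-\alpha}\sum_{k\in\mathbb{Z}}\frac{1}{|2k+1|^{2-\alpha}}$$ (so $C(0)=1$).
   Context: $X$ is a complex Banach space, $B(X)$ the bounded linear operators on $X$. Local spectrum $\sigma_T(x)=\mathbb{C}\setminus\rho_T(x)$, where $\rho_T(x)$ is the set of $\lambda\in\mathbb{C}$ having a neighbourhood $U$ and analytic $u:U\to X$ with $(zI-T)u(z)=x$ on $U$. SVEP: for every open $U$ the only analytic $u:U\to X$ with $(zI-T)u\equiv0$ is $u\equiv0$. The local spectral radius is $r_T(x)=\sup\{|\lambda|:\lambda\in\sigma_T(x)\}$ (with $\sup\emptyset=0$). *)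

theory Defs
  imports "HOL-Analysis.Analysis"
begin

class complex_banach = banach +
  fixes scaleC :: "complex \<Rightarrow> 'a \<Rightarrow> 'a" (infixr "*\<^sub>C" 75)
  assumes scaleC_add_right: "a *\<^sub>C (x + y) = a *\<^sub>C x + a *\<^sub>C y"
    and scaleC_add_left: "(a + b) *\<^sub>C x = a *\<^sub>C x + b *\<^sub>C x"
    and scaleC_scaleC: "a *\<^sub>C (b *\<^sub>C x) = (a * b) *\<^sub>C x"
    and scaleC_of_real: "complex_of_real r *\<^sub>C x = r *\<^sub>R x"
    and norm_scaleC: "norm (a *\<^sub>C x) = cmod a * norm x"

definition bounded_clinear_op :: "('a::complex_banach \<Rightarrow> 'a) \<Rightarrow> bool" where
  "bounded_clinear_op T \<longleftrightarrow> bounded_linear T \<and> (\<forall>c x. T (c *\<^sub>C x) = c *\<^sub>C T x)"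

definition analytic_X :: "(complex \<Rightarrow> 'a::complex_banach) \<Rightarrow> complex set \<Rightarrow> bool" where
  "analytic_X u U \<longleftrightarrow> open U \<and> (\<forall>z\<in>U. \<exists>d. (u has_derivative (\<lambda>h. h *\<^sub>C d)) (at z))"

definition local_resolvent :: "('a::complex_banach \<Rightarrow> 'a) \<Rightarrow> 'a \<Rightarrow> complex set" where
  "local_resolvent T x = {w. \<exists>U u. open U \<and> w \<in> U \<and> analytic_X u U \<and>
       (\<forall>z\<in>U. z *\<^sub>C u z - T (u z) = x)}"

definition local_spectrum :: "('a::complex_banach \<Rightarrow> 'a) \<Rightarrow> 'a \<Rightarrow> complex set" where
  "local_spectrum T x = - local_resolvent T x"

definition SVEP :: "('a::complex_banach \<Rightarrow> 'a) \<Rightarrow> bool" where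
  "SVEP T \<longleftrightarrow> (\<forall>U u. open U \<and> analytic_X u U \<and> (\<forall>z\<in>U. z *\<^sub>C u z - T (u z) = 0)
       \<longrightarrow> (\<forall>z\<in>U. u z = 0))"

definition local_spectral_radius :: "('a::complex_banach \<Rightarrow> 'a) \<Rightarrow> 'a \<Rightarrow> real" where
  "local_spectral_radius T x =
     (if local_spectrum T x = {} then 0 else (SUP w\<in>local_spectrum T x. cmod w))"

definition exp_op :: "real \<Rightarrow> ('a::complex_banach \<Rightarrow> 'a) \<Rightarrow> 'a \<Rightarrow> 'a" where
  "exp_op t T x = (\<Sum>n. (t ^ n / fact n) *\<^sub>R (T ^^ n) x)"

text \<open>Real power |t|^a with the convention 0^0 = 1 (Isabelle's powr has 0 powr 0 = 0).\<close>
definition rpow :: "real \<Rightarrow> real \<Rightarrow> real" where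
  "rpow s a = (if s = 0 then (if a = 0 then 1 else 0) else s powr a)"

definition C_alpha :: "real \<Rightarrow> real" where
  "C_alpha \<alpha> = (2 / pi) powr (2 - \<alpha>) * (\<Sum>\<^sub>\<infinity>k::int. 1 / \<bar>2 * real_of_int k + 1\<bar> powr (2 - \<alpha>))"

end

theory Submission
  imports Defs "HOL-Complex_Analysis.Complex_Analysis"
begin

text \<open>
  Choose a complex-linear functional \<open>\<phi>\<close> of norm at most one with \<open>\<bar>\<phi> (T x)\<bar> = \<parallel>T x\<parallel>\<close> and put
  \<open>f z = \<phi> (exp (z T) x) = \<Sum>n. \<phi> (T\<^sup>n x) z\<^sup>n / n!\<close>, so that \<open>f' 0 = \<phi> (T x)\<close>. By SVEP the local resolvents
  glue to one analytic function outside the disc of radius \<open>r = r\<^sub>T(x)\<close>; read at \<open>1/z\<close>, it shows that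
  \<open>\<phi> (T\<^sup>n x) = O(R\<^sup>n)\<close> for every \<open>R > r\<close>. Hence \<open>f\<close> has exponential type at most \<open>r\<close>, while it grows like
  \<open>\<bar>t\<bar>\<^sup>\<alpha>\<close> on the real line. For \<open>\<sigma> > r\<close>, multiplying by \<open>sin (\<epsilon> z) / (\<epsilon> z)\<close> makes it bounded on the
  real line at the cost of a slightly larger type, Phragmen-Lindeloef bounds it by \<open>B exp (\<sigma> \<bar>Im z\<bar>)\<close>, and
  M. Riesz's interpolation formula
  \<open>f' 0 = 4\<sigma>/\<pi>\<^sup>2 \<Sum>k. (-1)\<^sup>k f ((2k+1)\<pi>/(2\<sigma>)) / (2k+1)\<^sup>2\<close>
  gives the estimate with \<open>\<sigma>\<close> in place of \<open>r\<close>. Finally \<open>\<sigma>\<close> tends to \<open>r\<close>.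
\<close>

section \<open>Norming functionals\<close>

text \<open>Homogeneity is required only as an inequality for positive factors, which is easy to
  verify for infima. Applied to \<open>inverse c\<close> it becomes the equality of
  \<open>sublinear_scaleR\<close>.\<close>

definition sublinear :: "('v::real_vector \<Rightarrow> real) \<Rightarrow> bool" where
  "sublinear p \<longleftrightarrow> (\<forall>x y. p (x + y) \<le> p x + p y) \<and> (\<forall>c x. c > 0 \<longrightarrow> p (c *\<^sub>R x) \<le> c * p x)"

lemma sublinear_add: "sublinear p \<Longrightarrow> p (x + y) \<le> p x + p y"
  by (simp add: sublinear_def)

lemma sublinear_zero:
  assumes "sublinear p" shows "p 0 = 0"
proof -
  have "p 0 \<le> c * p 0" if "c > 0" for c :: real
    using assms that unfolding sublinear_def by (metis scaleR_zero_right)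
  from this[of 2] this[of "1/2"] show ?thesis by simp
qed

lemma sublinear_scaleR:
  assumes "sublinear p" "c \<ge> 0" shows "p (c *\<^sub>R x) = c * p x"
proof (cases "c = 0")
  case True
  then show ?thesis using sublinear_zero[OF assms(1)] by simp
next
  case False
  then have c: "c > 0" using assms by simp
  have "p (inverse c *\<^sub>R (c *\<^sub>R x)) \<le> inverse c * p (c *\<^sub>R x)"
    using assms(1) c unfolding sublinear_def by (metis inverse_positive_iff_positive)
  then have "c * p x \<le> p (c *\<^sub>R x)" using c by (simp add: field_simps)
  moreover have "p (c *\<^sub>R x) \<le> c * p x" using assms(1) c unfolding sublinear_def by blast
  ultimately show ?thesis by simp
qed

lemma sublinear_minus_le:
  assumes "sublinear p" shows "- p (- x) \<le> p x"
  using sublinear_add[OF assms, of x "- x"] sublinear_zero[OF assms] by simp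

lemma sublinear_norm: "sublinear (norm :: 'v::real_normed_vector \<Rightarrow> real)"
  by (auto simp: sublinear_def norm_triangle_ineq)

text \<open>The functional is the infimum over t \<ge> 0 of p (x + t a) - t p a. The choice t = 0
  puts it below p, and t = 1 at -a gives the value p 0 - p a.\<close>

lemma sublinear_lowering:
  fixes p :: "'v::real_vector \<Rightarrow> real"
  assumes p: "sublinear p"
  obtains q where "sublinear q" "q \<le> p" "q (- a) \<le> - p a"
proof
  define q where "q x = (INF t\<in>{0..}. p (x + t *\<^sub>R a) - t * p a)" for x
  have bdd: "bdd_below ((\<lambda>t. p (x + t *\<^sub>R a) - t * p a) ` {0..})" for x
  proof (rule bdd_belowI2)
    fix t :: real assume t: "t \<in> {0..}"
    have "p (t *\<^sub>R a) \<le> p (x + t *\<^sub>R a) + p (- x)"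
      using sublinear_add[OF p, of "x + t *\<^sub>R a" "- x"] by simp
    then show "- p (- x) \<le> p (x + t *\<^sub>R a) - t * p a"
      using sublinear_scaleR[OF p, of t a] t by simp
  qed
  have lower: "q x \<le> p (x + t *\<^sub>R a) - t * p a" if "t \<ge> 0" for x t
    unfolding q_def using that by (intro cINF_lower bdd) auto
  have greatest: "m \<le> q x" if "\<And>t. t \<ge> 0 \<Longrightarrow> m \<le> p (x + t *\<^sub>R a) - t * p a" for m x
    unfolding q_def using that by (intro cINF_greatest) auto
  have add: "q (x + y) \<le> q x + q y" for x y
  proof -
    have "q (x + y) - q x \<le> q y"
    proof (rule greatest)
      fix t :: real assume t: "t \<ge> 0"
      have "q (x + y) - (p (y + t *\<^sub>R a) - t * p a) \<le> q x"
      proof (rule greatest)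
        fix s :: real assume s: "s \<ge> 0"
        have "q (x + y) \<le> p ((x + s *\<^sub>R a) + (y + t *\<^sub>R a)) - (s + t) * p a"
          using lower[of "s + t" "x + y"] s t by (simp add: algebra_simps)
        also have "\<dots> \<le> p (x + s *\<^sub>R a) + p (y + t *\<^sub>R a) - (s + t) * p a"
          using sublinear_add[OF p] by simp
        finally show "q (x + y) - (p (y + t *\<^sub>R a) - t * p a) \<le> p (x + s *\<^sub>R a) - s * p a"
          by (simp add: algebra_simps)
      qed
      then show "q (x + y) - q x \<le> p (y + t *\<^sub>R a) - t * p a" by simp
    qed
    then show ?thesis by simp
  qed
  have scale: "q (c *\<^sub>R x) \<le> c * q x" if c: "c > 0" for c x
  proof -
    have "q (c *\<^sub>R x) / c \<le> q x"
    proof (rule greatest)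
      fix t :: real assume t: "t \<ge> 0"
      have "q (c *\<^sub>R x) \<le> p (c *\<^sub>R (x + t *\<^sub>R a)) - (c * t) * p a"
        using lower[of "c * t" "c *\<^sub>R x"] c t by (simp add: algebra_simps)
      also have "\<dots> = c * (p (x + t *\<^sub>R a) - t * p a)"
        using c by (subst sublinear_scaleR[OF p]) (auto simp: algebra_simps)
      finally show "q (c *\<^sub>R x) / c \<le> p (x + t *\<^sub>R a) - t * p a"
        using c by (simp add: field_simps)
    qed
    then show ?thesis using c by (simp add: field_simps)
  qed
  show "sublinear q" using add scale by (simp add: sublinear_def)
  show "q \<le> p" using lower[of 0] by (simp add: le_fun_def)
  show "q (- a) \<le> - p a" using lower[of 1 "- a"] sublinear_zero[OF p] by simp
qed

text \<open>Working with minimal sublinear functionals avoids the extension of partial functionals: by Zorn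
  there is one below any given \<open>p\<close>, and the lowering above shows that it is linear.\<close>

lemma sublinear_minimal_exists:
  fixes p :: "'v::real_vector \<Rightarrow> real"
  assumes p: "sublinear p"
  obtains m where "sublinear m" "m \<le> p" "\<And>q. sublinear q \<Longrightarrow> q \<le> m \<Longrightarrow> q = m"
proof -
  define A where "A = {q. sublinear q \<and> q \<le> p}"
  have "\<exists>m\<in>A. \<forall>a\<in>A. m \<ge> a \<longrightarrow> a = m"
  proof (rule predicate_Zorn)
    show "partial_order_on A (relation_of (\<ge>) A)"
      by (rule partial_order_on_relation_ofI) auto
  next
    fix C assume "C \<in> Chains (relation_of (\<ge>) A)"
    then have CA: "C \<subseteq> A" and chain: "\<And>f g. f \<in> C \<Longrightarrow> g \<in> C \<Longrightarrow> f \<le> g \<or> g \<le> f"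
      by (auto simp: Chains_def relation_of_def)
    show "\<exists>u\<in>A. \<forall>a\<in>C. a \<ge> u"
    proof (cases "C = {}")
      case True
      then show ?thesis using p by (auto simp: A_def)
    next
      case False
      define u where "u x = (INF f\<in>C. f x)" for x
      \<comment> \<open>Every member f of the chain satisfies -p (-x) \<le> -f (-x) \<le> f x, so
        the pointwise infimum is finite.\<close>
      have bdd: "bdd_below ((\<lambda>f. f x) ` C)" for x
      proof (rule bdd_belowI2)
        fix f assume "f \<in> C"
        then have f: "sublinear f" "f \<le> p" using CA by (auto simp: A_def)
        then show "- p (- x) \<le> f x"
          using sublinear_minus_le[OF f(1), of x] by (auto simp: le_fun_def intro: order_trans[rotated])
      qed
      have lower: "u x \<le> f x" if "f \<in> C" for x f
        unfolding u_def using that bdd by (intro cINF_lower)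
      have greatest: "c \<le> u x" if "\<And>f. f \<in> C \<Longrightarrow> c \<le> f x" for c x
        unfolding u_def using that False by (intro cINF_greatest)
      have "u (x + y) \<le> u x + u y" for x y
      proof -
        have "u (x + y) - u x \<le> u y"
        proof (rule greatest)
          fix g assume g: "g \<in> C"
          have "u (x + y) - g y \<le> u x"
          proof (rule greatest)
            fix f assume f: "f \<in> C"
            \<comment> \<open>Subadditivity passes to the infimum because C is a chain: one member h
              lies below both f and g, so the split happens inside h alone.\<close>
            obtain h where h: "h \<in> C" "h \<le> f" "h \<le> g" using chain[OF f g] f g by blast
            have "u (x + y) \<le> h (x + y)" using lower h by blast
            also have "\<dots> \<le> h x + h y" using h CA by (auto simp: A_def intro: sublinear_add)
            also have "\<dots> \<le> f x + g y" using h by (auto simp: le_fun_def intro: add_mono)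
            finally show "u (x + y) - g y \<le> f x" by simp
          qed
          then show "u (x + y) - u x \<le> g y" by simp
        qed
        then show ?thesis by simp
      qed
      moreover have "u (c *\<^sub>R x) \<le> c * u x" if c: "c > 0" for c x
      proof -
        have "u (c *\<^sub>R x) / c \<le> u x"
        proof (rule greatest)
          fix f assume f: "f \<in> C"
          then have "sublinear f" using CA by (auto simp: A_def)
          then have "f (c *\<^sub>R x) = c * f x" using c sublinear_scaleR[of f c x] by simp
          then show "u (c *\<^sub>R x) / c \<le> f x" using lower[OF f, of "c *\<^sub>R x"] c by (simp add: field_simps)
        qed
        then show ?thesis using c by (simp add: field_simps)
      qed
      ultimately have "sublinear u" by (simp add: sublinear_def)
      moreover have "u \<le> p"
      proof -
        obtain f where "f \<in> C" using False by blast
        then show ?thesis using lower[of f] CA by (force simp: A_def le_fun_def intro: order_trans)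
      qed
      ultimately show ?thesis using lower by (auto simp: A_def le_fun_def)
    qed
  qed
  then show ?thesis using that by (force simp: A_def)
qed

text \<open>By minimality, lowering m in direction a changes nothing, so m (-a) \<le> -m a and m is
  odd. Subadditivity at -x and -y then gives the reverse inequality at x and y.\<close>

lemma sublinear_minimal_linear:
  assumes m: "sublinear m" and min: "\<And>q. sublinear q \<Longrightarrow> q \<le> m \<Longrightarrow> q = m"
  shows "linear m"
proof -
  have neg: "m (- a) = - m a" for a
  proof -
    obtain q where "sublinear q" "q \<le> m" "q (- a) \<le> - m a" using sublinear_lowering[OF m] .
    then have "m (- a) \<le> - m a" using min by auto
    then show ?thesis using sublinear_minus_le[OF m, of "- a"] by simp
  qed
  have "m (x + y) = m x + m y" for x y
    using sublinear_add[OF m, of x y] sublinear_add[OF m, of "- x" "- y"] neg[of x] neg[of y]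
      neg[of "x + y"] by simp
  moreover have "m (c *\<^sub>R x) = c *\<^sub>R m x" for c x
  proof (cases "c \<ge> 0")
    case True
    then show ?thesis using sublinear_scaleR[OF m] by simp
  next
    case False
    then show ?thesis using sublinear_scaleR[OF m, of "- c" x] neg[of "c *\<^sub>R x"] by simp
  qed
  ultimately show ?thesis by (rule linearI)
qed

text \<open>The norm is first lowered in direction y. Any linear functional below the result
  satisfies m (-y) \<le> -norm y, hence attains the norm at y.\<close>

lemma real_norming_functional:
  fixes y :: "'v::real_normed_vector"
  obtains \<psi> where "linear \<psi>" "\<And>x. \<psi> x \<le> norm x" "\<psi> y = norm y"
proof -
  obtain q :: "'v \<Rightarrow> real" where q: "sublinear q" "q \<le> norm" "q (- y) \<le> - norm y"
    using sublinear_lowering[OF sublinear_norm] .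
  obtain m where m: "sublinear m" "m \<le> q" "\<And>q. sublinear q \<Longrightarrow> q \<le> m \<Longrightarrow> q = m"
    using sublinear_minimal_exists[OF q(1)] by metis
  have lin: "linear m" using sublinear_minimal_linear[OF m(1,3)] .
  have le: "m x \<le> norm x" for x using m(2) q(2) by (auto simp: le_fun_def intro: order_trans)
  have "- m y \<le> - norm y"
    using m(2) q(3) linear_neg[OF lin, of y] by (metis le_fun_def order_trans)
  then show ?thesis using that[OF lin le] le[of y] by simp
qed

section \<open>Complex scalars and complex-linear functionals\<close>

lemma scaleC_one [simp]: "1 *\<^sub>C x = x"
  using scaleC_of_real[of 1 x] by simp

lemma scaleC_minus_left: "(- a) *\<^sub>C x = - (a *\<^sub>C x)"
  using scaleC_add_left[of "- a" a x] scaleC_of_real[of 0 x] by (simp add: eq_neg_iff_add_eq_0)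

lemma scaleC_diff_left: "(a - b) *\<^sub>C x = a *\<^sub>C x - b *\<^sub>C x"
  using scaleC_add_left[of a "- b" x] by (simp add: scaleC_minus_left)

lemma scaleC_diff_right: "a *\<^sub>C (x - y) = a *\<^sub>C x - a *\<^sub>C y"
  using scaleC_add_right[of a "x - y" y] by simp

lemma scaleC_zero_right [simp]: "a *\<^sub>C (0::'a::complex_banach) = 0"
  using norm_scaleC[of a "0::'a"] by simp

lemma scaleC_minus_right: "a *\<^sub>C (- x) = - (a *\<^sub>C x)"
  using scaleC_diff_right[of a 0 x] by simp

lemma scaleR_scaleC_commute: "r *\<^sub>R (a *\<^sub>C x) = a *\<^sub>C (r *\<^sub>R x)"
  by (simp add: scaleC_of_real[symmetric] scaleC_scaleC mult.commute)

text \<open>Complexification of a real functional: \<open>\<phi> x\<close> is \<psi> x - i \<psi> (i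
  x). Its real part is \<psi>, and a rotation of x transfers the bound from the real part to the
  modulus.\<close>

lemma complex_norming_functional:
  fixes y :: "'a::complex_banach"
  obtains \<phi> :: "'a \<Rightarrow> complex" where "bounded_linear \<phi>" "\<And>c x. \<phi> (c *\<^sub>C x) = c * \<phi> x"
    "\<And>x. cmod (\<phi> x) \<le> norm x" "cmod (\<phi> y) = norm y"
proof -
  obtain \<psi> where lin: "linear \<psi>" and le: "\<And>x. \<psi> x \<le> norm x" and y: "\<psi> y = norm y"
    using real_norming_functional[of y] by blast
  define \<phi> where "\<phi> x = Complex (\<psi> x) (- \<psi> (\<i> *\<^sub>C x))" for x
  have linC: "linear \<phi>"
    by (rule linearI)
       (simp_all add: \<phi>_def linear_add[OF lin] linear_scale[OF lin] scaleC_add_right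
          scaleR_scaleC_commute[symmetric] complex_eq_iff)
  have hom: "\<phi> (c *\<^sub>C x) = c * \<phi> x" for c x
  proof -
    have i: "\<phi> (\<i> *\<^sub>C x) = \<i> * \<phi> x" for x
      using scaleC_minus_left[of 1 x]
      by (simp add: \<phi>_def complex_eq_iff scaleC_scaleC linear_neg[OF lin])
    have "c *\<^sub>C x = Re c *\<^sub>R x + Im c *\<^sub>R (\<i> *\<^sub>C x)"
      by (simp add: scaleC_of_real[symmetric] scaleC_scaleC scaleC_add_left[symmetric])
         (metis complex_eq mult.commute)
    then have "\<phi> (c *\<^sub>C x) = Re c *\<^sub>R \<phi> x + Im c *\<^sub>R (\<i> * \<phi> x)"
      by (simp add: linear_add[OF linC] linear_scale[OF linC] i)
    then show ?thesis by (simp add: complex_eq_iff)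
  qed
  have bound: "cmod (\<phi> x) \<le> norm x" for x
  proof (cases "\<phi> x = 0")
    case False
    \<comment> \<open>The unimodular factor that turns \<open>\<phi> x\<close> into the nonnegative
      real number |\<phi> x|.\<close>
    define u where "u = cnj (\<phi> x) / cmod (\<phi> x)"
    have u: "cmod u = 1" using False by (simp add: u_def norm_divide)
    have "cnj (\<phi> x) * \<phi> x = cmod (\<phi> x) * cmod (\<phi> x)"
      by (metis complex_norm_square mult.commute of_real_mult power2_eq_square)
    then have "u * \<phi> x = cmod (\<phi> x)"
      using False by (simp add: u_def)
    then have "cmod (\<phi> x) = Re (\<phi> (u *\<^sub>C x))" by (simp add: hom)
    also have "\<dots> = \<psi> (u *\<^sub>C x)" by (simp add: \<phi>_def)
    also have "\<dots> \<le> norm x" using le[of "u *\<^sub>C x"] u by (simp add: norm_scaleC)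
    finally show ?thesis .
  qed simp
  have bl: "bounded_linear \<phi>"
    using linC bound by (intro bounded_linear_intro[where K = 1]) (auto simp: linear_add linear_scale)
  have "norm y \<le> cmod (\<phi> y)" using complex_Re_le_cmod[of "\<phi> y"] y by (simp add: \<phi>_def)
  then show ?thesis using that[OF bl hom bound] bound[of y] by simp
qed

section \<open>The Phragmen-Lindeloef principle\<close>

text \<open>The product is z^(3/2). For |arg z| \<le> pi/4 its argument is at most 3 pi/8 < pi/2 in
  modulus, so its real part is comparable to |z|^(3/2). With csqrt z = a + i b the real part is a
  (a^2 - 3 b^2).\<close>

lemma Re_mult_csqrt_ge:
  assumes "\<bar>Im z\<bar> \<le> Re z"
  shows "Re (z * csqrt z) \<ge> 1/8 * (cmod z * sqrt (cmod z))"
proof -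
  define a b where "a = Re (csqrt z)" and "b = Im (csqrt z)"
  have a: "a \<ge> 0" unfolding a_def by (rule Re_csqrt)
  have sq: "csqrt z * csqrt z = z" by (metis power2_csqrt power2_eq_square)
  have Re: "Re z = a * a - b * b" and Im: "Im z = 2 * a * b"
    unfolding a_def b_def by (subst sq[symmetric], simp)+
  \<comment> \<open>The square root has argument at most pi/8 in modulus, and tan (pi/8) <
    1/2.\<close>
  have b: "2 * \<bar>b\<bar> \<le> a"
  proof (cases "a = 0")
    case True
    then have "b * b = 0" using assms Re Im zero_le_square[of b] by simp
    then show ?thesis using True by simp
  next
    case False
    have "2 * (a * \<bar>b\<bar>) \<le> a * a - b * b" using assms a unfolding Re Im by (simp add: abs_mult mult.assoc)
    then have "a * (2 * \<bar>b\<bar>) \<le> a * a" using zero_le_square[of b] by linarith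
    then show ?thesis using False a by simp
  qed
  have b2: "4 * b\<^sup>2 \<le> a\<^sup>2"
    using power_mono[OF b, of 2] by (simp add: power_mult_distrib)
  have cmod: "cmod z = (cmod (csqrt z))\<^sup>2"
    by (metis norm_power power2_csqrt)
  have cs: "(cmod (csqrt z))\<^sup>2 = a\<^sup>2 + b\<^sup>2" unfolding cmod_power2 a_def b_def ..
  have "(cmod (csqrt z))\<^sup>2 \<le> (5/4 * a)\<^sup>2"
  proof -
    have "(5/4 * a)\<^sup>2 = 25/16 * a\<^sup>2" by (simp add: power2_eq_square)
    then show ?thesis unfolding cs using b2 zero_le_power2[of a] by linarith
  qed
  then have le: "cmod (csqrt z) \<le> 5/4 * a" by (rule power2_le_imp_le) (use a in simp)
  have "cmod z * sqrt (cmod z) = cmod (csqrt z) ^ 3"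
  proof -
    have "cmod z * sqrt (cmod z) = (cmod (csqrt z))\<^sup>2 * cmod (csqrt z)"
      by (subst (1) cmod) (simp only: norm_csqrt)
    then show ?thesis by (simp only: power3_eq_cube power2_eq_square)
  qed
  also have "\<dots> \<le> (5/4 * a) ^ 3" using le by (intro power_mono) auto
  \<comment> \<open>(5/4)^3 = 125/64 < 2. Together with a^3 / 4 \<le> Re (z csqrt z) this yields the
    constant 1/8.\<close>
  also have "\<dots> \<le> 2 * a ^ 3" using a by (simp add: power_mult_distrib power3_eq_cube)
  finally have 1: "cmod z * sqrt (cmod z) \<le> 2 * a ^ 3" .
  have "Re (z * csqrt z) = a * (a\<^sup>2 - 3 * b\<^sup>2)"
  proof -
    have "Re (z * csqrt z) = Re z * a - Im z * b"
      unfolding a_def b_def by (rule times_complex.sel)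
    then show ?thesis unfolding Re Im by (simp add: power2_eq_square algebra_simps)
  qed
  moreover have "a * (a\<^sup>2 / 4) \<le> a * (a\<^sup>2 - 3 * b\<^sup>2)" using a b2 by (intro mult_left_mono) auto
  ultimately have "a ^ 3 / 4 \<le> Re (z * csqrt z)" by (simp add: power3_eq_cube power2_eq_square)
  then show ?thesis using 1 by simp
qed

text \<open>The sector has opening pi/2, whose critical order is 2. The exponent 3/2 lies strictly
  between the order 1 of G and 2, so damping by exp (-d z^(3/2)) permits the maximum principle on a
  truncated sector. Letting d tend to 0 removes the damping.\<close>

lemma phragmen_lindelof_sector:
  fixes G :: "complex \<Rightarrow> complex"
  assumes hol: "G holomorphic_on UNIV"
    and growth: "\<And>z. cmod (G z) \<le> M * exp (c * cmod z)"
    and bdry: "\<And>z. \<bar>Im z\<bar> = Re z \<Longrightarrow> cmod (G z) \<le> B"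
    and B: "B > 0"
    and z: "\<bar>Im z\<bar> \<le> Re z"
  shows "cmod (G z) \<le> B"
proof -
  have M: "M \<ge> 0" using order_trans[OF norm_ge_zero growth[of 0]] by simp
  have damped: "cmod (G z * exp (- (of_real d * (z * csqrt z)))) \<le> B" if d: "d > 0" for d :: real
  proof -
    \<comment> \<open>The damping factor decays like \<open>exp (- c \<bar>w\<bar>\<^sup>3\<^sup>/\<^sup>2)\<close> in the sector, which beats every exponential type.\<close>
    define H where "H w = G w * exp (- (of_real d * (w * csqrt w)))" for w
    have H: "cmod (H w) = cmod (G w) * exp (- (d * Re (w * csqrt w)))" for w
      unfolding H_def norm_mult norm_exp_eq_Re by simp
    have Hbdry: "cmod (H w) \<le> B" if w: "\<bar>Im w\<bar> = Re w" for w
    proof -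
      have "0 \<le> 1/8 * (cmod w * sqrt (cmod w))" by simp
      also have "\<dots> \<le> Re (w * csqrt w)" using w by (intro Re_mult_csqrt_ge) simp
      finally have "exp (- (d * Re (w * csqrt w))) \<le> 1"
        using d by simp
      then have "cmod (H w) \<le> B * 1"
        unfolding H using bdry[OF w] B by (intro mult_mono) auto
      then show ?thesis by simp
    qed
    \<comment> \<open>The three lower bounds put z inside the truncated sector, make M / r \<le> B,
      and make d/8 sqrt r \<ge> c + 1, so that on the arc the damping beats the growth with a factor
      exp (-r) to spare.\<close>
    define r where "r = max (cmod z + 1) (max (M / B) ((8 * (\<bar>c\<bar> + 1) / d)\<^sup>2))"
    have r: "r > cmod z" "r \<ge> M / B" "r \<ge> (8 * (\<bar>c\<bar> + 1) / d)\<^sup>2" by (auto simp: r_def)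
    have r0: "r > 0" using r(1) norm_ge_zero le_less_trans by blast
    have Harc: "cmod (H w) \<le> B" if w: "\<bar>Im w\<bar> \<le> Re w" "cmod w = r" for w
    proof -
      have "8 * (\<bar>c\<bar> + 1) / d \<le> sqrt r" using r(3) d by (simp add: real_le_rsqrt)
      then have "c + 1 \<le> d / 8 * sqrt r" using d by (simp add: field_simps)
      then have "r * (c + 1) \<le> r * (d / 8 * sqrt r)" using r0 by (intro mult_left_mono) auto
      also have "\<dots> = d * (1/8 * (cmod w * sqrt (cmod w)))" using w by simp
      also have "\<dots> \<le> d * Re (w * csqrt w)"
        using d by (intro mult_left_mono Re_mult_csqrt_ge w) auto
      finally have e: "c * r - d * Re (w * csqrt w) \<le> - r" by (simp add: algebra_simps)
      have "cmod (H w) \<le> M * exp (c * r) * exp (- (d * Re (w * csqrt w)))"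
        unfolding H using growth[of w] w by (intro mult_right_mono) auto
      also have "\<dots> = M * exp (c * r - d * Re (w * csqrt w))"
        unfolding exp_diff exp_minus by (simp only: divide_inverse mult.assoc)
      also have "\<dots> \<le> M * exp (- r)" using e M by (intro mult_left_mono) auto
      also have "\<dots> \<le> M * (1 / r)"
      proof -
        have "r \<le> exp r" using exp_ge_add_one_self[of r] by linarith
        then have "exp (- r) \<le> 1 / r" using r0 by (simp add: exp_minus field_simps)
        then show ?thesis using M by (intro mult_left_mono) auto
      qed
      also have "\<dots> \<le> B" using r(2) r0 B by (simp add: field_simps)
      finally show ?thesis .
    qed
    define S where "S = {w. \<bar>Im w\<bar> < Re w} \<inter> {w. cmod w < r}"
    define K where "K = {w. \<bar>Im w\<bar> \<le> Re w} \<inter> {w. cmod w \<le> r}"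
    have opS: "open S" unfolding S_def
      by (intro open_Int open_Collect_less continuous_intros)
    have clK: "closed K" unfolding K_def
      by (intro closed_Int closed_Collect_le continuous_intros)
    have SK: "closure S \<subseteq> K" using clK by (intro closure_minimal) (auto simp: S_def K_def)
    have front: "cmod (H w) \<le> B" if "w \<in> frontier S" for w
    proof -
      have "w \<in> K" "w \<notin> S" using that SK opS by (auto simp: frontier_def interior_open)
      then have "\<bar>Im w\<bar> = Re w \<or> \<bar>Im w\<bar> \<le> Re w \<and> cmod w = r" by (auto simp: S_def K_def)
      then show ?thesis using Hbdry Harc by blast
    qed
    have nonpos: "w \<notin> \<real>\<^sub>\<le>\<^sub>0" if "w \<in> S" for w
      using that by (auto simp: S_def complex_nonpos_Reals_iff)
    have holS: "H holomorphic_on interior S"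
      unfolding H_def interior_open[OF opS]
      by (intro holomorphic_intros holomorphic_on_subset[OF hol]) (use nonpos in auto)
    \<comment> \<open>The apex 0 belongs to K but lies on the branch cut. There continuity follows
      from |csqrt u| = sqrt |u|.\<close>
    have cont_csqrt: "continuous_on K csqrt"
      unfolding continuous_on_eq_continuous_within
    proof
      fix w assume w: "w \<in> K"
      show "continuous (at w within K) csqrt"
      proof (cases "w = 0")
        case True
        have "((\<lambda>u. sqrt (cmod u)) \<longlongrightarrow> sqrt (cmod 0)) (at 0 within K)"
          by (intro tendsto_intros)
        then have "((\<lambda>u. cmod (csqrt u)) \<longlongrightarrow> 0) (at 0 within K)" by simp
        then show ?thesis using True by (simp add: continuous_within tendsto_norm_zero_iff del: norm_csqrt)
      next
        case False
        then have "w \<notin> \<real>\<^sub>\<le>\<^sub>0"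
          using w by (auto simp: K_def complex_nonpos_Reals_iff complex_eq_iff)
        then show ?thesis by (rule continuous_within_csqrt)
      qed
    qed
    have contK: "continuous_on K H"
      unfolding H_def
      by (intro continuous_intros cont_csqrt continuous_on_subset[OF holomorphic_on_imp_continuous_on[OF hol]]) auto
    have "cmod (H z) \<le> B"
    proof (cases "z \<in> S")
      case True
      show ?thesis
      proof (rule maximum_modulus_frontier[OF holS _ _ front True])
        show "continuous_on (closure S) H" using contK SK continuous_on_subset by blast
        show "bounded S" by (rule bounded_subset[OF bounded_cball[of 0 r]]) (auto simp: S_def)
      qed
    next
      case False
      then have "\<bar>Im z\<bar> = Re z" using z r(1) by (auto simp: S_def)
      then show ?thesis by (rule Hbdry)
    qed
    then show ?thesis by (simp add: H_def)
  qed
  have "((\<lambda>d. cmod (G z * exp (- (of_real d * (z * csqrt z))))) \<longlongrightarrow>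
      cmod (G z * exp (- (of_real 0 * (z * csqrt z))))) (at_right 0)"
    by (intro tendsto_intros)
  moreover have "\<forall>\<^sub>F d in at_right 0. cmod (G z * exp (- (of_real d * (z * csqrt z)))) \<le> B"
    using eventually_at_right_less by eventually_elim (rule damped)
  ultimately have "cmod (G z * exp (- (of_real 0 * (z * csqrt z)))) \<le> B"
    by (intro tendsto_upperbound) auto
  then show ?thesis by simp
qed

text \<open>The factor exp (i \<sigma> w) has modulus exp (-\<sigma> Im w). It leaves the real axis
  untouched and cancels the growth on the positive imaginary axis, where M \<le> B bounds the
  product. The sector principle is then applied to one quadrant of the upper half-plane.\<close>

lemma exponential_type_bound_upper:
  fixes f :: "complex \<Rightarrow> complex"
  assumes hol: "f holomorphic_on UNIV"
    and growth: "\<And>z. cmod (f z) \<le> M * exp (\<sigma> * cmod z)" and \<sigma>: "\<sigma> \<ge> 0"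
    and real: "\<And>t::real. cmod (f (of_real t)) \<le> B" and MB: "M \<le> B" and B: "B > 0"
    and z: "Im z \<ge> 0"
  shows "cmod (f z) \<le> B * exp (\<sigma> * Im z)"
proof -
  define F where "F w = f w * exp (\<i> * of_real \<sigma> * w)" for w
  have F: "cmod (F w) = cmod (f w) * exp (- (\<sigma> * Im w))" for w
    unfolding F_def norm_mult norm_exp_eq_Re by simp
  have M: "M \<ge> 0" using order_trans[OF norm_ge_zero growth[of 0]] by simp
  \<comment> \<open>Multiplication by \<open>u\<close> rotates the sector \<open>\<bar>Im w\<bar> \<le> Re w\<close> onto the quadrant containing \<open>z\<close>.\<close>
  obtain s :: real where s: "s = 1 \<or> s = -1" "s * Re z \<ge> 0"
    by (metis linear mult_1 mult_minus1 neg_0_le_iff_le)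
  define u where "u = Complex (s / sqrt 2) (1 / sqrt 2)"
  have u: "cmod u = 1" using s by (auto simp: u_def cmod_def power_divide)
  have uu: "u * (cnj u * z) = z"
    using complex_norm_square[of u] u by (simp add: mult.assoc[symmetric])
  have Fbdry: "cmod (F (u * w)) \<le> B" if w: "\<bar>Im w\<bar> = Re w" for w
  proof -
    \<comment> \<open>The two boundary rays of the sector are rotated onto a real half-axis and the
      positive imaginary axis.\<close>
    have "Im (u * w) = 0 \<or> Re (u * w) = 0 \<and> Im (u * w) \<ge> 0"
      using w s by (auto simp: u_def abs_if field_simps split: if_splits)
    then show ?thesis
    proof
      assume "Im (u * w) = 0"
      then have "of_real (Re (u * w)) = u * w" by (simp add: complex_eq_iff)
      then show ?thesis using real[of "Re (u * w)"] \<open>Im (u * w) = 0\<close> unfolding F by simp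
    next
      assume 0: "Re (u * w) = 0 \<and> Im (u * w) \<ge> 0"
      then have "cmod (u * w) = Im (u * w)" by (simp add: cmod_eq_Im)
      then have "cmod (f (u * w)) \<le> M * exp (\<sigma> * Im (u * w))" using growth[of "u * w"] by simp
      then have "cmod (F (u * w)) \<le> M * exp (\<sigma> * Im (u * w)) * exp (- (\<sigma> * Im (u * w)))"
        unfolding F by (intro mult_right_mono) auto
      also have "\<dots> = M" by (simp add: exp_minus)
      finally show ?thesis using MB by simp
    qed
  qed
  have "cmod (F (u * (cnj u * z))) \<le> B"
  \<comment> \<open>The type doubles because |exp (i \<sigma> w)| can itself be as large as exp
    (\<sigma> |w|). Only finiteness of the type matters here.\<close>
  proof (rule phragmen_lindelof_sector[where G = "\<lambda>w. F (u * w)" and M = M and c = "2 * \<sigma>", OF _ _ Fbdry B])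
    show "(\<lambda>w. F (u * w)) holomorphic_on UNIV"
    proof -
      have "(f \<circ> (\<lambda>w. u * w)) holomorphic_on UNIV"
        by (intro holomorphic_on_compose holomorphic_intros holomorphic_on_subset[OF hol]) auto
      then show ?thesis unfolding F_def o_def by (intro holomorphic_intros)
    qed
    show "cmod (F (u * w)) \<le> M * exp (2 * \<sigma> * cmod w)" for w
    proof -
      have n: "cmod (u * w) = cmod w" using u by (simp add: norm_mult)
      have "- (\<sigma> * Im (u * w)) \<le> \<sigma> * cmod w"
      proof -
        have "- Im (u * w) \<le> cmod w" using abs_Im_le_cmod[of "u * w"] n by linarith
        from mult_left_mono[OF this \<sigma>] show ?thesis by (simp only: mult_minus_right)
      qed
      then have "cmod (F (u * w)) \<le> M * exp (\<sigma> * cmod w) * exp (\<sigma> * cmod w)"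
        unfolding F using growth[of "u * w"] M unfolding n by (intro mult_mono) auto
      then show ?thesis by (simp add: mult_exp_exp mult.assoc)
    qed
    show "\<bar>Im (cnj u * z)\<bar> \<le> Re (cnj u * z)"
      using s z by (auto simp: u_def field_simps abs_if mult_le_0_iff zero_le_mult_iff)
  qed
  then have "cmod (f z) * exp (- (\<sigma> * Im z)) \<le> B" by (simp only: uu F)
  then show ?thesis by (simp add: exp_minus field_simps)
qed

lemma exponential_type_bound:
  fixes f :: "complex \<Rightarrow> complex"
  assumes hol: "f holomorphic_on UNIV"
    and growth: "\<And>z. cmod (f z) \<le> M * exp (\<sigma> * cmod z)" and \<sigma>: "\<sigma> \<ge> 0"
    and real: "\<And>t::real. cmod (f (of_real t)) \<le> B" and MB: "M \<le> B" and B: "B > 0"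
  shows "cmod (f z) \<le> B * exp (\<sigma> * \<bar>Im z\<bar>)"
proof (cases "Im z \<ge> 0")
  case True
  then show ?thesis using exponential_type_bound_upper[OF hol growth \<sigma> real MB B] by simp
next
  case False
  have "cmod (f (- (- z))) \<le> B * exp (\<sigma> * Im (- z))"
  proof (rule exponential_type_bound_upper[where f = "\<lambda>w. f (- w)", OF _ _ \<sigma> _ MB B])
    show "(\<lambda>w. f (- w)) holomorphic_on UNIV"
    proof -
      have "(f \<circ> (\<lambda>w. - w)) holomorphic_on UNIV"
        by (intro holomorphic_on_compose holomorphic_intros holomorphic_on_subset[OF hol]) auto
      then show ?thesis by (simp add: o_def)
    qed
    show "cmod (f (- w)) \<le> M * exp (\<sigma> * cmod w)" for w using growth[of "- w"] by simp
    show "cmod (f (- of_real t)) \<le> B" for t using real[of "- t"] by simp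
  qed (use False in auto)
  then show ?thesis using False by simp
qed

section \<open>The interpolation formula of M. Riesz\<close>

text \<open>The circle crosses the real axis at integer multiples of pi, midway between zeros of the
  cosine. With z = x + i y one has |cos z|^2 = cos^2 x + sinh^2 y. For |y| \<ge> 1 the second term
  suffices; otherwise x is close to a multiple of pi and the first does.\<close>

lemma exp_abs_Im_le_cmod_cos:
  assumes z: "cmod z = pi * real N" and N: "N \<ge> 1"
  shows "exp \<bar>Im z\<bar> \<le> 4 * cmod (cos z)"
proof -
  define y where "y = \<bar>Im z\<bar>"
  have y: "y \<ge> 0" by (simp add: y_def)
  have sq: "(cmod (cos z))\<^sup>2 = (cos (Re z))\<^sup>2 + (exp y - exp (- y))\<^sup>2 / 4"
    unfolding norm_cos_squared y_def by (simp add: exp_minus abs_if power2_commute)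
  have four: "(4 * cmod (cos z))\<^sup>2 = 16 * (cmod (cos z))\<^sup>2" by (simp add: power_mult_distrib)
  have "(exp y)\<^sup>2 \<le> (4 * cmod (cos z))\<^sup>2"
  proof (cases "y \<ge> 1")
    case True
    have "2 \<le> exp y" using exp_ge_add_one_self[of y] True by linarith
    then have "exp (- y) \<le> 1 / 2" by (simp add: exp_minus field_simps)
    then have "exp y - exp (- y) \<ge> exp y / 2" using \<open>2 \<le> exp y\<close> by linarith
    then have "(exp y / 2)\<^sup>2 \<le> (exp y - exp (- y))\<^sup>2" by (intro power_mono) auto
    moreover have "(exp y / 2)\<^sup>2 = (exp y)\<^sup>2 / 4" by (simp add: power_divide)
    ultimately show ?thesis
      using sq four zero_le_power2[of "cos (Re z)"] zero_le_power2[of "exp y - exp (- y)"] by linarith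
  next
    case False
    have "exp y \<le> exp 1" using False by simp
    then have "exp y \<le> 3" using exp_le by linarith
    then have e: "(exp y)\<^sup>2 \<le> 9" using power_mono[of "exp y" 3 2] by simp
    \<comment> \<open>The defect satisfies \<delta> (pi N + |Re z|) = y^2 \<le> 1 and pi N \<ge> 3,
      hence \<delta> \<le> 1/3. Then cos^2 (Re z) \<ge> 8/9, and 16 * 8/9 exceeds the bound 9 for
      exp (2 y).\<close>
    define \<delta> where "\<delta> = pi * real N - \<bar>Re z\<bar>"
    have \<delta>0: "\<delta> \<ge> 0" using abs_Re_le_cmod[of z] z by (simp add: \<delta>_def)
    have "3 \<le> pi * real N" using pi_gt3 N mult_mono[of 3 pi 1 "real N"] by simp
    then have "\<delta> * 3 \<le> \<delta> * (pi * real N + \<bar>Re z\<bar>)" using \<delta>0 by (intro mult_left_mono) auto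
    also have "\<dots> = (cmod z)\<^sup>2 - (Re z)\<^sup>2"
      by (simp add: \<delta>_def z power2_eq_square algebra_simps)
    also have "\<dots> = y\<^sup>2" by (simp add: cmod_power2 y_def)
    also have "\<dots> \<le> 1" using False y by (simp add: power_le_one)
    finally have "\<delta> \<le> 1/3" by simp
    have "(sin (Re z))\<^sup>2 = (sin \<bar>Re z\<bar>)\<^sup>2" by (simp add: abs_if)
    also have "\<bar>Re z\<bar> = real N * pi - \<delta>" by (simp add: \<delta>_def)
    also have "(sin (real N * pi - \<delta>))\<^sup>2 = (sin \<delta>)\<^sup>2"
      by (simp add: sin_diff power_mult_distrib flip: power_mult)
    also have "\<dots> \<le> (1/3)\<^sup>2"
    proof (intro power2_le_iff_abs_le[THEN iffD2])
      show "\<bar>sin \<delta>\<bar> \<le> 1/3" using abs_sin_x_le_abs_x[of \<delta>] \<delta>0 \<open>\<delta> \<le> 1/3\<close> by linarith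
    qed simp
    finally have "(cos (Re z))\<^sup>2 \<ge> 8/9" by (simp add: cos_squared_eq power_divide)
    then show ?thesis using sq four e zero_le_power2[of "exp y - exp (- y)"] by linarith
  qed
  then show ?thesis unfolding y_def by (rule power2_le_imp_le) simp
qed

section \<open>Zeros of the cosine and residues at them\<close>

definition cos_zero :: "int \<Rightarrow> real" where
  "cos_zero k = (2 * real_of_int k + 1) * pi / 2"

lemma abs_cos_zero: "\<bar>cos_zero k\<bar> = \<bar>2 * real_of_int k + 1\<bar> * pi / 2"
  unfolding cos_zero_def by (simp add: abs_mult)

lemma cos_zero_nonzero: "cos_zero k \<noteq> 0"
proof -
  have "2 * k + 1 \<noteq> 0" by presburger
  then have "real_of_int (2 * k + 1) \<noteq> 0" by (simp only: of_int_eq_0_iff not_False_eq_True)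
  then show ?thesis by (simp add: cos_zero_def)
qed

lemma cos_cos_zero [simp]: "cos (cos_zero k) = 0"
proof -
  have "cos_zero k = real_of_int k * pi + pi / 2" by (simp add: cos_zero_def algebra_simps add_divide_distrib)
  then show ?thesis unfolding cos_zero_iff_int2 by blast
qed

lemma abs_sin_cos_zero [simp]: "\<bar>sin (cos_zero k)\<bar> = 1"
  using sin_cos_squared_add[of "cos_zero k"] by (simp add: power2_eq_1_iff abs_if) fastforce

lemma cos_complex_eq_0: "cos z = 0 \<longleftrightarrow> (\<exists>k. z = complex_of_real (cos_zero k))"
proof -
  have "complex_of_real (real_of_int k * pi) + complex_of_real pi / 2 = complex_of_real (cos_zero k)" for k
    by (simp add: cos_zero_def field_simps)
  then show ?thesis unfolding cos_eq_0 by simp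
qed

text \<open>The pole is simple with residue F x / (x^2 (- sin x)), and |sin x| = 1 at a zero of the
  cosine. The exponent is written \<open>Suc 1\<close> to match the coefficient formula
  \<open>fps_coeff_residues_bound\<close> for the first Taylor coefficient.\<close>

lemma residue_over_cos:
  assumes hol: "F holomorphic_on UNIV"
  shows "cmod (residue (\<lambda>w. F w / cos w / w ^ Suc 1) (of_real (cos_zero k)))
    = cmod (F (of_real (cos_zero k))) / (cos_zero k)\<^sup>2"
proof -
  let ?x = "complex_of_real (cos_zero k)"
  have x0: "?x \<noteq> 0" using cos_zero_nonzero by simp
  have c0: "cos ?x = 0" by (simp add: cos_of_real)
  have s: "cmod (sin ?x) = 1" by (simp add: sin_of_real)
  have "((\<lambda>w. (cos w - cos ?x) / (w - ?x)) \<longlongrightarrow> - sin ?x) (at ?x)"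
    using DERIV_cos[of ?x] by (simp add: has_field_derivative_iff)
  then have l: "((\<lambda>w. cos w / (w - ?x)) \<longlongrightarrow> - sin ?x) (at ?x)" by (simp only: c0 diff_zero)
  have Fc: "isCont F ?x"
    using holomorphic_on_imp_continuous_on[OF hol] by (simp add: continuous_on_eq_continuous_at)
  have "((\<lambda>w. F w / w ^ Suc 1 / (cos w / (w - ?x))) \<longlongrightarrow> F ?x / ?x ^ Suc 1 / (- sin ?x)) (at ?x)"
    using s x0 by (intro tendsto_intros l isContD[OF Fc]) auto
  then have lim: "((\<lambda>w. F w / cos w / w ^ Suc 1 * (w - ?x)) \<longlongrightarrow> F ?x / ?x ^ Suc 1 / (- sin ?x)) (at ?x)"
    by (simp add: field_simps)
  have "\<exists>e>0. \<forall>w\<in>ball ?x e - {?x}. cos w \<noteq> 0"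
  proof -
    have "\<forall>\<^sub>F w in at ?x. cos w / (w - ?x) \<noteq> 0"
      using s by (intro tendsto_imp_eventually_ne[OF l]) auto
    then show ?thesis by (auto simp: eventually_at dist_commute) 
  qed
  then obtain e where e: "e > 0" "\<And>w. w \<in> ball ?x e - {?x} \<Longrightarrow> cos w \<noteq> 0" by blast
  \<comment> \<open>The radius is capped by |x| to keep the pole at 0 outside the
    neighbourhood.\<close>
  define A where "A = ball ?x (min e (cmod ?x))"
  have "residue (\<lambda>w. F w / cos w / w ^ Suc 1) ?x = F ?x / ?x ^ Suc 1 / (- sin ?x)"
  proof (rule residue_simple'[where s = A, OF _ _ _ lim])
    show "open A" "?x \<in> A" using e x0 by (auto simp: A_def)
    show "(\<lambda>w. F w / cos w / w ^ Suc 1) holomorphic_on A - {?x}"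
      using e by (intro holomorphic_intros holomorphic_on_subset[OF hol]) (auto simp: A_def dist_norm)
  qed
  then show ?thesis using s by (simp add: norm_divide norm_mult norm_power power2_eq_square)
qed

text \<open>Residue theorem for F w / (w^2 cos w) on the circles |w| = pi N. There |F / cos| \<le> 4
  B, so the integral is O(1/N), and F' 0 is balanced by the residues at the enclosed zeros. Only
  their moduli enter, so a bound on partial sums suffices.\<close>

lemma riesz_interpolation_bound:
  assumes hol: "F holomorphic_on UNIV"
    and growth: "\<And>z. cmod (F z) \<le> B * exp \<bar>Im z\<bar>"
    and sums: "\<And>N. (\<Sum>k\<in>{-int N..<int N}. cmod (F (of_real (cos_zero k))) / (cos_zero k)\<^sup>2) \<le> L"
  shows "cmod (deriv F 0) \<le> L"
proof -
  have B: "B \<ge> 0" using order_trans[OF norm_ge_zero growth[of 0]] by simp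
  have bound: "cmod (deriv F 0) \<le> L + 4 * B / (pi * real N)" if N: "N \<ge> 1" for N :: nat
  proof -
    define S where "S = (\<lambda>k. complex_of_real (cos_zero k)) ` {-int N..<int N}"
    have inj: "inj_on (\<lambda>k. complex_of_real (cos_zero k)) {-int N..<int N}"
    proof (rule inj_onI)
      fix j k assume "complex_of_real (cos_zero j) = complex_of_real (cos_zero k)"
      then have "(2 * real_of_int j + 1) * pi = (2 * real_of_int k + 1) * pi"
        unfolding of_real_eq_iff cos_zero_def by simp
      then show "j = k" by simp
    qed
    have finS: "finite S" by (simp add: S_def)
    \<comment> \<open>The first zero outside the circle has modulus pi N + pi/2 > pi N + 1. Hence f
      is holomorphic off S on a ball slightly larger than the disc enclosed by the circle.\<close>
    have mem: "z \<in> S" if cz: "cos z = 0" and "cmod z < pi * real N + 1" for z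
    proof -
      obtain k where k: "z = of_real (cos_zero k)" using cz cos_complex_eq_0 by blast
      have "\<bar>2 * real_of_int k + 1\<bar> * pi < (2 * real N) * pi + 2"
      proof -
        have "cmod z = \<bar>2 * real_of_int k + 1\<bar> * pi / 2"
          unfolding k norm_of_real by (rule abs_cos_zero)
        then show ?thesis using that(2) by (simp add: mult.commute)
      qed
      also have "\<dots> < (2 * real N + 1) * pi" using pi_gt3 by (simp add: algebra_simps)
      finally have "\<bar>2 * real_of_int k + 1\<bar> < 2 * real N + 1" by (rule mult_right_less_imp_less) simp
      then have "\<bar>2 * k + 1\<bar> < 2 * int N + 1" by linarith
      then show ?thesis unfolding S_def k by (intro imageI) auto
    qed
    have ball: "S \<subseteq> ball 0 (pi * real N)"
    proof
      fix z assume "z \<in> S"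
      then obtain k where k: "z = of_real (cos_zero k)" "- int N \<le> k" "k < int N" by (auto simp: S_def)
      have "\<bar>2 * k + 1\<bar> < 2 * int N" using k by linarith
      then have "\<bar>2 * real_of_int k + 1\<bar> * pi < (2 * real N) * pi" by (intro mult_strict_right_mono) auto
      then have "cmod z < pi * real N" unfolding k norm_of_real abs_cos_zero by simp
      then show "z \<in> ball 0 (pi * real N)" by simp
    qed
    \<comment> \<open>The residue of \<open>F w / (w\<^sup>2 cos w)\<close> at \<open>0\<close> is \<open>F' 0\<close>.\<close>
    define f where "f w = F w / cos w" for w
    have "cmod ((deriv ^^ 1) f 0 / fact 1 + (\<Sum>z\<in>S. residue (\<lambda>w. f w / w ^ Suc 1) z))
       \<le> 4 * B / (pi * real N) ^ 1"
    proof (rule fps_coeff_residues_bound[where A = "ball 0 (pi * real N + 1)" and k = "{}"])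
      show "f holomorphic_on ball 0 (pi * real N + 1) - S"
        unfolding f_def using mem by (intro holomorphic_intros holomorphic_on_subset[OF hol]) auto
      show "0 \<notin> S" using cos_zero_nonzero by (auto simp: S_def)
      show "cmod (f z) \<le> 4 * B" if "cmod z = pi * real N" for z
      proof -
        have c: "exp \<bar>Im z\<bar> \<le> 4 * cmod (cos z)" by (rule exp_abs_Im_le_cmod_cos[OF that N])
        then have "cmod (cos z) > 0" using exp_gt_zero[of "\<bar>Im z\<bar>"] by linarith
        moreover have "cmod (F z) \<le> B * (4 * cmod (cos z))"
          using growth[of z] mult_left_mono[OF c B] by linarith
        ultimately show ?thesis by (simp add: f_def norm_divide field_simps)
      qed
    qed (use N ball finS B in \<open>auto simp: cball_subset_ball_iff\<close>)
    \<comment> \<open>At 0 the cosine has value 1 and derivative 0.\<close>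
    moreover have "deriv f 0 = deriv F 0"
    proof -
      have "(F has_field_derivative deriv F 0) (at 0)"
        by (rule holomorphic_derivI[OF hol]) auto
      then have "(f has_field_derivative deriv F 0) (at 0)"
        unfolding f_def by (auto intro!: derivative_eq_intros)
      then show ?thesis by (rule DERIV_imp_deriv)
    qed
    ultimately have 1: "cmod (deriv F 0 + (\<Sum>z\<in>S. residue (\<lambda>w. f w / w ^ Suc 1) z)) \<le> 4 * B / (pi * real N)"
      by simp
    have "cmod (\<Sum>z\<in>S. residue (\<lambda>w. f w / w ^ Suc 1) z) \<le> (\<Sum>z\<in>S. cmod (residue (\<lambda>w. f w / w ^ Suc 1) z))"
      by (rule norm_sum)
    also have "\<dots> = (\<Sum>k\<in>{-int N..<int N}. cmod (F (of_real (cos_zero k))) / (cos_zero k)\<^sup>2)"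
      unfolding S_def f_def sum.reindex[OF inj] o_def residue_over_cos[OF hol] ..
    also have "\<dots> \<le> L" by (rule sums)
    finally show ?thesis using 1 norm_triangle_ineq4[of "deriv F 0 + (\<Sum>z\<in>S. residue (\<lambda>w. f w / w ^ Suc 1) z)"
      "\<Sum>z\<in>S. residue (\<lambda>w. f w / w ^ Suc 1) z"] by simp
  qed
  have "((\<lambda>N. L + 4 * B / (pi * real N)) \<longlongrightarrow> L + 0) sequentially"
    by (intro tendsto_intros tendsto_divide_0[OF tendsto_const] filterlim_at_top_imp_at_infinity
        filterlim_tendsto_pos_mult_at_top[OF tendsto_const pi_gt_zero] filterlim_real_sequentially)
  moreover have "\<forall>\<^sub>F N in sequentially. cmod (deriv F 0) \<le> L + 4 * B / (pi * real N)"
    using eventually_ge_at_top[of "1::nat"] by eventually_elim (rule bound)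
  ultimately show ?thesis by (intro tendsto_lowerbound[where F = sequentially]) auto
qed

section \<open>Bernstein's inequality with polynomial growth\<close>

lemma sum_int_symmetric:
  fixes g :: "int \<Rightarrow> real"
  shows "(\<Sum>k\<in>{-int N..<int N}. g k) = (\<Sum>n<N. g (int n) + g (- int n - 1))"
proof (induction N)
  case (Suc N)
  have "{-int (Suc N)..<int (Suc N)} = insert (int N) (insert (- int N - 1) {-int N..<int N})"
    by auto
  then show ?case using Suc by simp
qed simp

text \<open>Removing the even terms from the Basel sum removes a quarter of it: pi^2/6 - pi^2/24 =
  pi^2/8. The partial sums increase to this limit.\<close>

lemma sum_inverse_odd_squares_le: "(\<Sum>n<N. 1 / (2 * real n + 1)\<^sup>2) \<le> pi\<^sup>2 / 8"
proof -
  define S where "S N = (\<Sum>n<N. 1 / (real n + 1)\<^sup>2)" for N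
  define O' where "O' N = (\<Sum>n<N. 1 / (2 * real n + 1)\<^sup>2)" for N
  have S: "S \<longlonglongrightarrow> pi\<^sup>2 / 6"
    using inverse_squares_sums unfolding sums_def S_def by (simp add: add.commute)
  have split: "O' N = S (2 * N) - S N / 4" for N
  proof (induction N)
    case (Suc N)
    have "1 / (2 * real N + 2)\<^sup>2 = 1 / (real N + 1)\<^sup>2 / 4"
      by (simp add: power2_eq_square field_simps)
    then show ?case using Suc by (simp add: S_def O'_def add.commute add.left_commute add_divide_distrib)
  qed (simp add: S_def O'_def)
  have "(\<lambda>N. S (2 * N)) \<longlonglongrightarrow> pi\<^sup>2 / 6"
    using filterlim_compose[OF S, of "\<lambda>N. 2 * N"] mult_nat_left_at_top[of 2] by (simp add: o_def)
  then have "O' \<longlonglongrightarrow> pi\<^sup>2 / 6 - pi\<^sup>2 / 6 / 4"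
    unfolding split by (intro tendsto_intros S) simp_all
  moreover have "incseq O'" by (rule incseq_SucI) (simp add: O'_def)
  ultimately have "O' N \<le> pi\<^sup>2 / 6 - pi\<^sup>2 / 6 / 4" by (rule incseq_le[rotated])
  then show ?thesis by (simp add: O'_def)
qed

lemma sum_inverse_cos_zero_squares_le:
  "(\<Sum>k\<in>{-int N..<int N}. 1 / (cos_zero k)\<^sup>2) \<le> 1"
proof -
  have 1: "1 / (cos_zero (int n))\<^sup>2 = 4 / pi\<^sup>2 * (1 / (2 * real n + 1)\<^sup>2)" for n
    by (simp add: cos_zero_def power2_eq_square)
  \<comment> \<open>The indices k and -k - 1 enumerate opposite zeros, so the range from -N to N - 1
    is symmetric.\<close>
  have 2: "(cos_zero (- int n - 1))\<^sup>2 = (cos_zero (int n))\<^sup>2" for n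
  proof -
    have "cos_zero (- int n - 1) = - cos_zero (int n)" by (simp add: cos_zero_def algebra_simps)
    then show ?thesis by simp
  qed
  have "(\<Sum>k\<in>{-int N..<int N}. 1 / (cos_zero k)\<^sup>2) = 8 / pi\<^sup>2 * (\<Sum>n<N. 1 / (2 * real n + 1)\<^sup>2)"
    unfolding sum_int_symmetric 1 2 sum_distrib_left by (intro sum.cong refl) simp
  also have "\<dots> \<le> 8 / pi\<^sup>2 * (pi\<^sup>2 / 8)"
    by (intro mult_left_mono sum_inverse_odd_squares_le) simp
  finally show ?thesis by simp
qed

text \<open>Both halves of the integers are compared with the sum of (n + 1)^(-p). An infinite sum
  takes the default value 0 when it does not converge, so summability is what allows partial sums to
  be bounded by \<open>C_alpha\<close>.\<close>

lemma odd_powr_summable_on: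
  assumes p: "p > 1"
  shows "(\<lambda>k::int. 1 / \<bar>2 * real_of_int k + 1\<bar> powr p) summable_on UNIV"
proof -
  let ?g = "\<lambda>k::int. 1 / \<bar>2 * real_of_int k + 1\<bar> powr p"
  have "summable (\<lambda>n. real (Suc n) powr - p)"
    using p by (subst summable_Suc_iff) (simp add: summable_real_powr_iff)
  then have sn: "summable (\<lambda>n. 1 / (2 * real n + 1) powr p)"
  proof (rule summable_comparison_test'[where N = 0])
    fix n :: nat
    show "norm (1 / (2 * real n + 1) powr p) \<le> real (Suc n) powr - p"
      using p by (simp add: powr_minus_divide frac_le powr_mono2)
  qed
  then have nat: "(\<lambda>n. 1 / (2 * real n + 1) powr p) summable_on UNIV"
    by (intro norm_summable_imp_summable_on) simp
  have "?g summable_on range int"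
    by (subst summable_on_reindex) (use nat in \<open>auto simp: o_def inj_on_def add.commute\<close>)
  moreover have "?g summable_on range (\<lambda>n. - int n - 1)"
  proof (subst summable_on_reindex)
    have "(?g \<circ> (\<lambda>n. - int n - 1)) = (\<lambda>n. 1 / (2 * real n + 1) powr p)"
      by (simp add: o_def fun_eq_iff) 
    then show "(?g \<circ> (\<lambda>n. - int n - 1)) summable_on UNIV" using nat by simp
  qed (auto simp: inj_on_def)
  moreover have "range int \<inter> range (\<lambda>n. - int n - 1) = {}" by auto
  ultimately have "?g summable_on (range int \<union> range (\<lambda>n. - int n - 1))"
    by (rule summable_on_Un_disjoint)
  moreover have "k \<in> range int \<union> range (\<lambda>n. - int n - 1)" for k
  proof (cases "k \<ge> 0")
    case True
    then show ?thesis by (metis UnI1 nonneg_int_cases rangeI)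
  next
    case False
    then have "k = - int (nat (- k - 1)) - 1" by simp
    then show ?thesis by blast
  qed
  ultimately show ?thesis by (metis UNIV_eq_I)
qed

text \<open>\<open>C_alpha \<alpha>\<close> is the sum of |x|^(\<alpha> - 2) over all zeros x of the
  cosine; the factor (2/pi)^(2 - \<alpha>) comes from |x| = |2k + 1| pi/2.\<close>

lemma sum_cos_zero_powr_le:
  assumes "0 \<le> \<alpha>" "\<alpha> < 1"
  shows "(\<Sum>k\<in>{-int N..<int N}. \<bar>cos_zero k\<bar> powr \<alpha> / (cos_zero k)\<^sup>2) \<le> C_alpha \<alpha>"
proof -
  have "\<bar>cos_zero k\<bar> powr \<alpha> / (cos_zero k)\<^sup>2
      = (2 / pi) powr (2 - \<alpha>) * (1 / \<bar>2 * real_of_int k + 1\<bar> powr (2 - \<alpha>))" for k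
  proof -
    have x: "\<bar>cos_zero k\<bar> > 0" using cos_zero_nonzero by simp
    have "\<bar>cos_zero k\<bar> powr \<alpha> / (cos_zero k)\<^sup>2 = \<bar>cos_zero k\<bar> powr \<alpha> / \<bar>cos_zero k\<bar> powr 2"
      using x by simp
    also have "\<dots> = 1 / \<bar>cos_zero k\<bar> powr (2 - \<alpha>)"
      by (simp add: powr_diff)
    also have "\<dots> = (1 / \<bar>cos_zero k\<bar>) powr (2 - \<alpha>)" by (simp add: powr_divide)
    also have "1 / \<bar>cos_zero k\<bar> = (2 / pi) * (1 / \<bar>2 * real_of_int k + 1\<bar>)"
      by (simp add: abs_cos_zero)
    finally show ?thesis by (simp add: powr_mult powr_divide)
  qed
  then have "(\<Sum>k\<in>{-int N..<int N}. \<bar>cos_zero k\<bar> powr \<alpha> / (cos_zero k)\<^sup>2)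
    = (2 / pi) powr (2 - \<alpha>) * (\<Sum>k\<in>{-int N..<int N}. 1 / \<bar>2 * real_of_int k + 1\<bar> powr (2 - \<alpha>))"
    by (simp add: sum_distrib_left)
  also have "\<dots> \<le> C_alpha \<alpha>"
    unfolding C_alpha_def using assms
    by (intro mult_left_mono finite_sum_le_infsum odd_powr_summable_on) auto
  finally show ?thesis .
qed

section \<open>The multiplier sin z / z\<close>

definition csinc :: "complex \<Rightarrow> complex" where
  "csinc z = (if z = 0 then 1 else sin z / z)"

text \<open>The function is the difference quotient of the sine at 0, completed by its derivative
  there, so the singularity is removable.\<close>

lemma csinc_holomorphic: "csinc holomorphic_on UNIV"
proof -
  have "deriv sin (0::complex) = 1" using DERIV_sin[of "0::complex"] by (auto dest: DERIV_imp_deriv)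
  then have "csinc = (\<lambda>z. if z = 0 then deriv sin 0 else (sin z - sin 0) / (z - 0))"
    by (simp add: csinc_def fun_eq_iff)
  then show ?thesis using pole_lemma_open[of sin UNIV 0] by (simp add: holomorphic_intros)
qed

lemma csinc_0 [simp]: "csinc 0 = 1"
  by (simp add: csinc_def)

lemma csinc_minus [simp]: "csinc (- z) = csinc z"
  by (simp add: csinc_def)

text \<open>The derivative of an even function vanishes at 0. With \<open>csinc 0 = 1\<close>,
  multiplication by a rescaled \<open>csinc\<close> therefore preserves the derivative at 0.\<close>

lemma csinc_has_derivative_0: "(csinc has_field_derivative 0) (at 0)"
proof -
  have D: "(csinc has_field_derivative deriv csinc 0) (at 0)"
    by (rule holomorphic_derivI[OF csinc_holomorphic]) auto
  have "((\<lambda>z. csinc (- z)) has_field_derivative deriv csinc 0 * - 1) (at 0)"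
    by (rule DERIV_chain2[where f = csinc]) (use D in \<open>auto intro!: derivative_eq_intros\<close>)
  then have "(csinc has_field_derivative deriv csinc 0 * - 1) (at 0)" by simp
  then have "deriv csinc 0 * - 1 = deriv csinc 0" using D DERIV_unique by blast
  then have "deriv csinc 0 = 0" by simp
  then show ?thesis using D by simp
qed

lemma csinc_growth: obtains K where "K \<ge> 0" "\<And>z. cmod (csinc z) \<le> K * exp (cmod z)"
proof -
  have "bounded (csinc ` cball 0 1)"
    by (intro compact_imp_bounded compact_continuous_image compact_cball
        continuous_on_subset[OF holomorphic_on_imp_continuous_on[OF csinc_holomorphic]]) auto
  then obtain K where K: "\<And>z. cmod z \<le> 1 \<Longrightarrow> cmod (csinc z) \<le> K"
    unfolding bounded_iff by (metis image_eqI mem_cball_0)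
  have "cmod (csinc z) \<le> max K 1 * exp (cmod z)" for z
  proof (cases "cmod z \<le> 1")
    case True
    have "cmod (csinc z) \<le> max K 1 * 1" using K[OF True] by simp
    also have "\<dots> \<le> max K 1 * exp (cmod z)" by (intro mult_left_mono) auto
    finally show ?thesis .
  next
    case False
    have "cmod (sin z) = cmod (exp (\<i> * z) - exp (- (\<i> * z))) / 2"
      by (simp add: sin_exp_eq norm_divide norm_mult)
    also have "\<dots> \<le> (cmod (exp (\<i> * z)) + cmod (exp (- (\<i> * z)))) / 2"
      by (intro divide_right_mono norm_triangle_ineq4) simp
    also have "\<dots> \<le> exp (cmod z)"
    proof -
      have "cmod (\<i> * z) = cmod z" "cmod (- (\<i> * z)) = cmod z" by (simp_all add: norm_mult)
      then have e: "cmod (exp (\<i> * z)) \<le> exp (cmod z)" "cmod (exp (- (\<i> * z))) \<le> exp (cmod z)"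
        by (metis norm_exp)+
      show ?thesis using add_mono[OF e] by simp
    qed
    finally have "cmod (sin z) \<le> exp (cmod z)" .
    moreover have "cmod (csinc z) \<le> cmod (sin z)"
      using False by (auto simp: csinc_def norm_divide divide_le_eq mult_le_cancel_left1)
    moreover have "1 * exp (cmod z) \<le> max K 1 * exp (cmod z)" by (intro mult_right_mono) auto
    ultimately show ?thesis by linarith
  qed
  then show ?thesis using that[of "max K 1"] by simp
qed

text \<open>The first bound keeps the constants sharp in the interpolation sum; the second supplies
  the decay that absorbs growth up to order |t|.\<close>

lemma csinc_real_le: "cmod (csinc (of_real t)) \<le> 1" "\<bar>t\<bar> * cmod (csinc (of_real t)) \<le> 1"
  using abs_sin_x_le_abs_x[of t]
  by (auto simp: csinc_def sin_of_real norm_divide divide_le_eq simp flip: of_real_divide)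

lemma rpow_le: "0 \<le> \<alpha> \<Longrightarrow> \<alpha> < 1 \<Longrightarrow> s \<ge> 0 \<Longrightarrow> rpow s \<alpha> \<le> 1 + s"
proof -
  assume a: "0 \<le> \<alpha>" "\<alpha> < 1" "s \<ge> 0"
  have "s powr \<alpha> \<le> 1 + s"
  proof (cases "s \<le> 1")
    case True
    then show ?thesis using a powr_mono2[of \<alpha> s 1] by simp
  next
    case False
    then show ?thesis using a powr_mono[of \<alpha> 1 s] by simp
  qed
  then show ?thesis using a by (simp add: rpow_def)
qed

text \<open>After rescaling by \<sigma> and multiplying by the sinc factor, the function has type 1
  and is bounded on the real line by some B. The size of B does not enter the result: the Riesz sum
  uses the original growth bound at the nodes and |csinc| \<le> 1.\<close>

lemma bernstein_inequality_growth:
  assumes hol: "f holomorphic_on UNIV"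
    and growth: "\<And>z. cmod (f z) \<le> M * exp (R * cmod z)" and R: "0 \<le> R" "R < \<sigma>"
    and \<alpha>: "0 \<le> \<alpha>" "\<alpha> < 1" and C: "C > 0"
    and real: "\<And>t. cmod (f (of_real t)) \<le> C * (1 + rpow \<bar>t\<bar> \<alpha>)"
  shows "cmod (deriv f 0) \<le> C * (\<sigma> + C_alpha \<alpha> * \<sigma> powr (1 - \<alpha>))"
proof -
  have \<sigma>: "\<sigma> > 0" using R by simp
  have M: "M \<ge> 0" using order_trans[OF norm_ge_zero growth[of 0]] by simp
  define \<epsilon> where "\<epsilon> = \<sigma> - R"
  have \<epsilon>: "\<epsilon> > 0" using R by (simp add: \<epsilon>_def)
  obtain K where K: "K \<ge> 0" "\<And>z. cmod (csinc z) \<le> K * exp (cmod z)" using csinc_growth by blast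
  \<comment> \<open>The types of the factors are R / \<sigma> and \<epsilon> / \<sigma>, which add
    up to exactly 1.\<close>
  define F where "F z = f (z / of_real \<sigma>) * csinc (of_real (\<epsilon> / \<sigma>) * z)" for z
  have holF: "F holomorphic_on UNIV"
  proof -
    have "(f \<circ> (\<lambda>z. z / of_real \<sigma>)) holomorphic_on UNIV"
      using \<sigma> by (intro holomorphic_on_compose holomorphic_intros holomorphic_on_subset[OF hol]) auto
    moreover have "(csinc \<circ> (\<lambda>z. of_real (\<epsilon> / \<sigma>) * z)) holomorphic_on UNIV"
      by (intro holomorphic_on_compose holomorphic_intros holomorphic_on_subset[OF csinc_holomorphic]) auto
    ultimately show ?thesis unfolding F_def o_def by (intro holomorphic_intros)
  qed
  have growthF: "cmod (F z) \<le> M * K * exp (1 * cmod z)" for z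
  proof -
    have "cmod (F z) \<le> (M * exp (R * (cmod z / \<sigma>))) * (K * exp (\<epsilon> / \<sigma> * cmod z))"
      unfolding F_def norm_mult using growth[of "z / of_real \<sigma>"] K(2)[of "of_real (\<epsilon> / \<sigma>) * z"] M \<epsilon> \<sigma>
      by (intro mult_mono) (auto simp: norm_mult norm_divide)
    also have "\<dots> = M * K * exp (R * (cmod z / \<sigma>) + \<epsilon> / \<sigma> * cmod z)"
      by (simp add: exp_add)
    also have "R * (cmod z / \<sigma>) + \<epsilon> / \<sigma> * cmod z = 1 * cmod z"
      using \<sigma> by (simp add: \<epsilon>_def field_simps)
    finally show ?thesis .
  qed
  \<comment> \<open>M K is included because the Phragmen-Lindeloef bound requires B to dominate the
    growth constant; the other term bounds F on the real line.\<close>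
  define B where "B = max (M * K) (2 * C + C / \<epsilon>)"
  have B: "B > 0" using C \<epsilon> by (auto simp: B_def less_max_iff_disj add_pos_pos)
  have realF: "cmod (F (of_real t)) \<le> B" for t
  proof -
    define u where "u = t / \<sigma>"
    have F: "F (of_real t) = f (of_real u) * csinc (of_real (\<epsilon> * u))" by (simp add: F_def u_def)
    have "C * (1 + rpow \<bar>u\<bar> \<alpha>) \<le> C * (2 + \<bar>u\<bar>)"
      using C rpow_le[OF \<alpha>, of "\<bar>u\<bar>"] by (intro mult_left_mono) auto
    then have "cmod (f (of_real u)) \<le> C * (2 + \<bar>u\<bar>)" using real[of u] by linarith
    then have "cmod (F (of_real t)) \<le> C * (2 + \<bar>u\<bar>) * cmod (csinc (of_real (\<epsilon> * u)))"
      unfolding F norm_mult by (rule mult_right_mono) simp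
    \<comment> \<open>The constant part is paired with the bound 1 for the sinc factor, the linear
      part with its decay.\<close>
    also have "\<dots> = 2 * C * cmod (csinc (of_real (\<epsilon> * u)))
        + C / \<epsilon> * (\<bar>\<epsilon> * u\<bar> * cmod (csinc (of_real (\<epsilon> * u))))"
      using \<epsilon> by (simp add: abs_mult algebra_simps)
    also have "\<dots> \<le> 2 * C * 1 + C / \<epsilon> * 1"
      using C \<epsilon> by (intro add_mono mult_left_mono csinc_real_le) auto
    finally show ?thesis by (simp add: B_def)
  qed
  have boundF: "cmod (F z) \<le> B * exp \<bar>Im z\<bar>" for z
    using exponential_type_bound[OF holF growthF _ realF _ B, of z] by (simp add: B_def)
  have "cmod (deriv F 0) \<le> C * (1 + C_alpha \<alpha> / \<sigma> powr \<alpha>)"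
  proof (rule riesz_interpolation_bound[OF holF boundF])
    fix N
    have "cmod (F (of_real (cos_zero k))) / (cos_zero k)\<^sup>2
        \<le> C * (1 / (cos_zero k)\<^sup>2 + \<bar>cos_zero k\<bar> powr \<alpha> / (cos_zero k)\<^sup>2 / \<sigma> powr \<alpha>)" for k
    proof -
      define t where "t = cos_zero k"
      have t: "t \<noteq> 0" using cos_zero_nonzero by (simp add: t_def)
      have "F (of_real t) = f (of_real (t / \<sigma>)) * csinc (of_real (\<epsilon> / \<sigma> * t))"
        by (simp add: F_def)
      then have "cmod (F (of_real t)) \<le> C * (1 + rpow \<bar>t / \<sigma>\<bar> \<alpha>) * 1"
        unfolding norm_mult
        using real[of "t / \<sigma>"] csinc_real_le(1)[of "\<epsilon> / \<sigma> * t"] order_trans[OF norm_ge_zero real[of "t / \<sigma>"]]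
        by (metis mult_mono norm_ge_zero norm_mult)
      \<comment> \<open>The nodes are nonzero, so the convention at 0 does not intervene.\<close>
      also have "rpow \<bar>t / \<sigma>\<bar> \<alpha> = \<bar>t\<bar> powr \<alpha> / \<sigma> powr \<alpha>"
        using t \<sigma> by (simp add: rpow_def powr_divide)
      finally have "cmod (F (of_real t)) / t\<^sup>2 \<le> C * (1 + \<bar>t\<bar> powr \<alpha> / \<sigma> powr \<alpha>) * 1 / t\<^sup>2"
        by (rule divide_right_mono) simp
      then show ?thesis unfolding t_def[symmetric] using t by (simp add: field_simps)
    qed
    then have "(\<Sum>k\<in>{-int N..<int N}. cmod (F (of_real (cos_zero k))) / (cos_zero k)\<^sup>2)
      \<le> (\<Sum>k\<in>{-int N..<int N}. C * (1 / (cos_zero k)\<^sup>2 + \<bar>cos_zero k\<bar> powr \<alpha> / (cos_zero k)\<^sup>2 / \<sigma> powr \<alpha>))"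
      by (rule sum_mono)
    also have "\<dots> = C * ((\<Sum>k\<in>{-int N..<int N}. 1 / (cos_zero k)\<^sup>2)
        + (\<Sum>k\<in>{-int N..<int N}. \<bar>cos_zero k\<bar> powr \<alpha> / (cos_zero k)\<^sup>2) / \<sigma> powr \<alpha>)"
      by (simp only: sum_distrib_left[symmetric] sum.distrib sum_divide_distrib)
    also have "\<dots> \<le> C * (1 + C_alpha \<alpha> / \<sigma> powr \<alpha>)"
      using C \<alpha> by (intro mult_left_mono add_mono divide_right_mono
          sum_inverse_cos_zero_squares_le sum_cos_zero_powr_le) auto
    finally show "(\<Sum>k\<in>{-int N..<int N}. cmod (F (of_real (cos_zero k))) / (cos_zero k)\<^sup>2)
      \<le> C * (1 + C_alpha \<alpha> / \<sigma> powr \<alpha>)" .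
  qed
  moreover have "deriv F 0 = deriv f 0 / of_real \<sigma>"
  proof -
    have "(f has_field_derivative deriv f 0) (at (0 / of_real \<sigma>))"
      using holomorphic_derivI[OF hol, of 0] by simp
    then have "((\<lambda>z. f (z / of_real \<sigma>)) has_field_derivative deriv f 0 * (1 / of_real \<sigma>)) (at 0)"
      by (rule DERIV_chain2) (use \<sigma> in \<open>auto intro!: derivative_eq_intros\<close>)
    moreover have "((\<lambda>z. csinc (of_real (\<epsilon> / \<sigma>) * z)) has_field_derivative 0 * of_real (\<epsilon> / \<sigma>)) (at 0)"
      by (rule DERIV_chain2[where f = csinc]) (use csinc_has_derivative_0 \<sigma> in \<open>auto intro!: derivative_eq_intros\<close>)
    ultimately have "(F has_field_derivative deriv f 0 / of_real \<sigma>) (at 0)"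
      unfolding F_def by (rule DERIV_mult[THEN DERIV_cong]) simp
    then show ?thesis by (rule DERIV_imp_deriv)
  qed
  ultimately have "cmod (deriv f 0) / \<sigma> \<le> C * (1 + C_alpha \<alpha> / \<sigma> powr \<alpha>)"
    using \<sigma> by (simp add: norm_divide)
  then have "cmod (deriv f 0) \<le> \<sigma> * (C * (1 + C_alpha \<alpha> / \<sigma> powr \<alpha>))"
    using \<sigma> by (simp add: divide_le_eq mult.commute)
  also have "\<dots> = C * (\<sigma> + C_alpha \<alpha> * \<sigma> powr (1 - \<alpha>))"
  proof -
    have "\<sigma> powr (1 - \<alpha>) = \<sigma> / \<sigma> powr \<alpha>" using \<sigma> by (simp add: powr_diff)
    then show ?thesis by (simp add: algebra_simps)
  qed
  finally show ?thesis .
qed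

section \<open>Local resolvents\<close>

lemma bounded_linear_scaleC_right: "bounded_linear (\<lambda>x. c *\<^sub>C x)"
  by (rule bounded_linear_intro[where K = "cmod c"])
     (auto simp: scaleC_add_right scaleR_scaleC_commute norm_scaleC mult.commute)

lemma bounded_linear_scaleC_left: "bounded_linear (\<lambda>c. c *\<^sub>C x)"
  by (rule bounded_linear_intro[where K = "norm x"])
     (auto simp: scaleC_add_left scaleC_scaleC[symmetric] scaleC_of_real scaleR_conv_of_real norm_scaleC)

lemma analytic_X_functional_holomorphic:
  fixes \<phi> :: "'a::complex_banach \<Rightarrow> complex"
  assumes \<phi>: "bounded_linear \<phi>" "\<And>c x. \<phi> (c *\<^sub>C x) = c * \<phi> x"
    and u: "analytic_X u U"
  shows "(\<lambda>z. \<phi> (u z)) holomorphic_on U"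
proof -
  have op: "open U" using u by (simp add: analytic_X_def)
  have "(\<lambda>z. \<phi> (u z)) field_differentiable at z" if z: "z \<in> U" for z
  proof -
    obtain d where "(u has_derivative (\<lambda>h. h *\<^sub>C d)) (at z)"
      using u z by (auto simp: analytic_X_def)
    then have "((\<lambda>z. \<phi> (u z)) has_derivative (\<lambda>h. \<phi> (h *\<^sub>C d))) (at z)"
      by (rule bounded_linear.has_derivative[OF \<phi>(1)])
    then have "((\<lambda>z. \<phi> (u z)) has_field_derivative \<phi> d) (at z)"
      by (simp add: \<phi>(2) has_field_derivative_def mult_commute_abs)
    then show ?thesis by (auto simp: field_differentiable_def)
  qed
  then show ?thesis using op by (simp add: holomorphic_on_open field_differentiable_def)
qed

lemma analytic_X_subset: "analytic_X u U \<Longrightarrow> V \<subseteq> U \<Longrightarrow> open V \<Longrightarrow> analytic_X u V"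
  by (auto simp: analytic_X_def)

lemma analytic_X_diff:
  assumes "analytic_X u U" "analytic_X v U"
  shows "analytic_X (\<lambda>z. u z - v z) U"
  unfolding analytic_X_def
proof (intro conjI ballI)
  show "open U" using assms by (simp add: analytic_X_def)
  fix z assume "z \<in> U"
  then obtain d e where "(u has_derivative (\<lambda>h. h *\<^sub>C d)) (at z)" "(v has_derivative (\<lambda>h. h *\<^sub>C e)) (at z)"
    using assms unfolding analytic_X_def by blast
  then have "((\<lambda>z. u z - v z) has_derivative (\<lambda>h. h *\<^sub>C (d - e))) (at z)"
    unfolding scaleC_diff_right by (rule has_derivative_diff)
  then show "\<exists>d. ((\<lambda>z. u z - v z) has_derivative (\<lambda>h. h *\<^sub>C d)) (at z)" by blast
qed

text \<open>On the overlap the difference of two solutions is analytic and solves the homogeneous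
  equation, so SVEP makes it vanish.\<close>

lemma SVEP_unique:
  assumes T: "bounded_clinear_op T" and svep: "SVEP T"
    and u: "analytic_X u U" "\<And>z. z \<in> U \<Longrightarrow> z *\<^sub>C u z - T (u z) = x"
    and v: "analytic_X v V" "\<And>z. z \<in> V \<Longrightarrow> z *\<^sub>C v z - T (v z) = x"
    and w: "w \<in> U" "w \<in> V"
  shows "u w = v w"
proof -
  have lin: "linear T" using T by (simp add: bounded_clinear_op_def bounded_linear.linear)
  have op: "open (U \<inter> V)" using u(1) v(1) by (auto simp: analytic_X_def)
  have "analytic_X (\<lambda>z. u z - v z) (U \<inter> V)"
    using op by (intro analytic_X_diff analytic_X_subset[OF u(1)] analytic_X_subset[OF v(1)]) auto
  moreover have "z *\<^sub>C (u z - v z) - T (u z - v z) = 0" if "z \<in> U \<inter> V" for z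
  proof -
    have "z *\<^sub>C (u z - v z) - T (u z - v z) = (z *\<^sub>C u z - T (u z)) - (z *\<^sub>C v z - T (v z))"
      by (simp add: scaleC_diff_right linear_diff[OF lin])
    then show ?thesis using u(2) v(2) that by simp
  qed
  ultimately have "\<forall>z\<in>U \<inter> V. u z - v z = 0"
    using svep op unfolding SVEP_def by blast
  then show ?thesis using w by auto
qed

section \<open>The resolvent outside the disc of radius \<open>onorm T\<close>\<close>

lemma resolvent_lower_bound:
  assumes T: "bounded_clinear_op T"
  shows "(cmod w - onorm T) * norm v \<le> norm (w *\<^sub>C v - T v)"
proof -
  have "norm (T v) \<le> onorm T * norm v" using T by (simp add: bounded_clinear_op_def onorm)
  moreover have "norm (w *\<^sub>C v) - norm (T v) \<le> norm (w *\<^sub>C v - T v)" by (rule norm_triangle_ineq2)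
  ultimately show ?thesis by (simp add: norm_scaleC algebra_simps)
qed

lemma norm_funpow_le:
  assumes T: "bounded_clinear_op T"
  shows "norm ((T ^^ n) y) \<le> onorm T ^ n * norm y"
proof (induction n)
  case (Suc n)
  have bl: "bounded_linear T" using T by (simp add: bounded_clinear_op_def)
  have "norm (T ((T ^^ n) y)) \<le> onorm T * norm ((T ^^ n) y)" by (rule onorm[OF bl])
  also have "\<dots> \<le> onorm T * (onorm T ^ n * norm y)"
    using Suc onorm_pos_le[OF bl] by (intro mult_left_mono) auto
  finally show ?case by (simp add: mult.assoc)
qed simp

text \<open>The Neumann series of (w - T)^(-1) y, used for |w| > \<open>onorm T\<close>.\<close>

definition resolvent_series :: "('a::complex_banach \<Rightarrow> 'a) \<Rightarrow> complex \<Rightarrow> 'a \<Rightarrow> 'a" where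
  "resolvent_series T w y = (\<Sum>n. inverse w ^ Suc n *\<^sub>C (T ^^ n) y)"

lemma summable_resolvent_series:
  assumes T: "bounded_clinear_op T" and w: "cmod w > onorm T"
  shows "summable (\<lambda>n. inverse w ^ Suc n *\<^sub>C (T ^^ n) y)"
proof (rule summable_comparison_test'[where N = 0])
  have K: "onorm T \<ge> 0" using T by (simp add: bounded_clinear_op_def onorm_pos_le)
  then have w0: "cmod w > 0" using w by linarith
  show "summable (\<lambda>n. norm y / cmod w * (onorm T / cmod w) ^ n)"
    using K w w0 by (intro summable_mult summable_geometric) (simp add: divide_less_eq)
  fix n
  have "norm (inverse w ^ Suc n *\<^sub>C (T ^^ n) y) \<le> inverse (cmod w) ^ Suc n * (onorm T ^ n * norm y)"
    unfolding norm_scaleC norm_power norm_inverse using norm_funpow_le[OF T, of n y]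
    by (intro mult_left_mono) auto
  also have "\<dots> = norm y / cmod w * (onorm T / cmod w) ^ n"
    by (simp add: power_divide field_simps)
  finally show "norm (inverse w ^ Suc n *\<^sub>C (T ^^ n) y) \<le> norm y / cmod w * (onorm T / cmod w) ^ n" .
qed

text \<open>Multiplying the series by w and applying T to it give the same series up to the leading
  term y.\<close>

lemma resolvent_series_eq:
  assumes T: "bounded_clinear_op T" and w: "cmod w > onorm T"
  shows "w *\<^sub>C resolvent_series T w y - T (resolvent_series T w y) = y"
proof -
  have bl: "bounded_linear T" and hom: "\<And>c x. T (c *\<^sub>C x) = c *\<^sub>C T x"
    using T by (auto simp: bounded_clinear_op_def)
  have w0: "w \<noteq> 0" using w onorm_pos_le[OF bl] by auto
  let ?s = "\<lambda>n. inverse w ^ Suc n *\<^sub>C (T ^^ n) y"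
  have s: "?s sums resolvent_series T w y"
    unfolding resolvent_series_def using summable_resolvent_series[OF T w] by (rule summable_sums)
  have "(\<lambda>n. w *\<^sub>C ?s n) sums (w *\<^sub>C resolvent_series T w y)"
    using bounded_linear_scaleC_right s by (rule bounded_linear.sums)
  then have 1: "(\<lambda>n. inverse w ^ n *\<^sub>C (T ^^ n) y) sums (w *\<^sub>C resolvent_series T w y)"
    using w0 by (simp add: scaleC_scaleC mult.assoc[symmetric])
  have "(\<lambda>n. T (?s n)) sums T (resolvent_series T w y)"
    using bl s by (rule bounded_linear.sums)
  then have "(\<lambda>n. inverse w ^ Suc n *\<^sub>C (T ^^ Suc n) y) sums T (resolvent_series T w y)"
    by (simp add: hom)
  then have "(\<lambda>n. inverse w ^ n *\<^sub>C (T ^^ n) y) sums (T (resolvent_series T w y) + y)"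
    by (subst (asm) sums_Suc_iff) simp
  with 1 have "w *\<^sub>C resolvent_series T w y = T (resolvent_series T w y) + y"
    by (rule sums_unique2)
  then show ?thesis by simp
qed

lemma resolvent_unique:
  assumes T: "bounded_clinear_op T" and w: "cmod w > onorm T"
    and v: "w *\<^sub>C v - T v = y"
  shows "v = resolvent_series T w y"
proof -
  have lin: "linear T" using T by (simp add: bounded_clinear_op_def bounded_linear.linear)
  let ?d = "v - resolvent_series T w y"
  have "w *\<^sub>C ?d - T ?d = (w *\<^sub>C v - T v) - (w *\<^sub>C resolvent_series T w y - T (resolvent_series T w y))"
    by (simp add: scaleC_diff_right linear_diff[OF lin])
  also have "\<dots> = 0" using v resolvent_series_eq[OF T w] by simp
  finally have "(cmod w - onorm T) * norm ?d \<le> 0" using resolvent_lower_bound[OF T, of w ?d] by simp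
  then show ?thesis using w by (simp add: mult_le_0_iff)
qed

lemma norm_resolvent_series_le:
  assumes T: "bounded_clinear_op T" and w: "cmod w > onorm T"
  shows "norm (resolvent_series T w y) \<le> norm y / (cmod w - onorm T)"
  using resolvent_lower_bound[OF T, of w "resolvent_series T w y"] w
  by (simp add: resolvent_series_eq[OF T w] field_simps)

text \<open>The first resolvent identity. Solving for the resolvent at z gives a candidate that
  satisfies the equation at z, and the solution there is unique.\<close>

lemma resolvent_identity:
  assumes T: "bounded_clinear_op T" and w: "cmod w > onorm T" and z: "cmod z > onorm T"
  shows "resolvent_series T z y - resolvent_series T w y
    = - ((z - w) *\<^sub>C resolvent_series T z (resolvent_series T w y))"
proof -
  have lin: "linear T" and hom: "\<And>c x. T (c *\<^sub>C x) = c *\<^sub>C T x"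
    using T by (auto simp: bounded_clinear_op_def bounded_linear.linear)
  define v where "v = resolvent_series T w y"
  define q where "q = resolvent_series T z v"
  have v: "w *\<^sub>C v - T v = y" unfolding v_def by (rule resolvent_series_eq[OF T w])
  have q: "z *\<^sub>C q - T q = v" unfolding q_def by (rule resolvent_series_eq[OF T z])
  have "z *\<^sub>C (v - (z - w) *\<^sub>C q) - T (v - (z - w) *\<^sub>C q)
      = (z *\<^sub>C v - T v) - (z - w) *\<^sub>C (z *\<^sub>C q - T q)"
    by (simp add: scaleC_diff_right linear_diff[OF lin] hom scaleC_scaleC mult.commute)
  also have "\<dots> = y" unfolding q using v by (simp add: scaleC_diff_left)
  finally have "v - (z - w) *\<^sub>C q = resolvent_series T z y" by (rule resolvent_unique[OF T z])
  from this[symmetric] show ?thesis by (simp add: v_def q_def)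
qed

text \<open>The derivative of the resolvent S at w is -S(w)^2. Two uses of the resolvent identity
  leave the remainder h^2 S(w + h) S(w)^2 x, and S(w + h) stays bounded for small h.\<close>

lemma resolvent_series_analytic:
  assumes T: "bounded_clinear_op T"
  shows "analytic_X (\<lambda>w. resolvent_series T w x) {w. cmod w > onorm T}"
  unfolding analytic_X_def
proof (intro conjI ballI)
  show "open {w. cmod w > onorm T}" by (intro open_Collect_less continuous_intros)
  fix w assume "w \<in> {w. cmod w > onorm T}"
  then have w: "cmod w > onorm T" by simp
  let ?S = "resolvent_series T"
  \<comment> \<open>Half the distance from |w| to \<open>onorm T\<close>: for |h| < e the point w +
    h still exceeds \<open>onorm T\<close> in modulus by at least e.\<close>
  define e where "e = (cmod w - onorm T) / 2"
  have e: "e > 0" using w by (simp add: e_def)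
  define D where "D = norm (?S w (?S w x)) / e"
  have "norm (?S (w + h) x - ?S w x - h *\<^sub>C (- ?S w (?S w x))) \<le> (D * norm h) * norm h"
    if h: "cmod h < e" for h
  proof -
    let ?z = "w + h"
    have "cmod w - cmod h \<le> cmod ?z" by (rule norm_diff_ineq)
    then have ze: "cmod ?z - onorm T \<ge> e" using h unfolding e_def by argo
    then have z: "cmod ?z > onorm T" using e by linarith
    have "?S ?z x - ?S w x - h *\<^sub>C (- ?S w (?S w x)) = - (h *\<^sub>C (?S ?z (?S w x) - ?S w (?S w x)))"
      using resolvent_identity[OF T w z, of x] by (simp add: scaleC_diff_right scaleC_minus_right)
    also have "\<dots> = h *\<^sub>C (h *\<^sub>C ?S ?z (?S w (?S w x)))"
      unfolding resolvent_identity[OF T w z] by (simp add: scaleC_minus_right)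
    finally have eq: "norm (?S ?z x - ?S w x - h *\<^sub>C (- ?S w (?S w x)))
        = norm (?S ?z (?S w (?S w x))) * norm h * norm h"
      by (simp add: norm_scaleC)
    have "norm (?S ?z (?S w (?S w x))) \<le> norm (?S w (?S w x)) / (cmod ?z - onorm T)"
      by (rule norm_resolvent_series_le[OF T z])
    also have "\<dots> \<le> D" unfolding D_def using ze e by (intro divide_left_mono) auto
    finally show ?thesis unfolding eq by (intro mult_right_mono) auto
  qed
  then have "\<forall>\<^sub>F h in at 0. norm (?S (w + h) x - ?S w x - h *\<^sub>C (- ?S w (?S w x))) \<le> (D * norm h) * norm h"
    using e by (auto simp: eventually_at intro!: exI[of _ e])
  then have ev: "\<forall>\<^sub>F h in at 0. norm (norm (?S (w + h) x - ?S w x - h *\<^sub>C (- ?S w (?S w x))) / norm h) \<le> D * norm h"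
    by eventually_elim (auto simp: divide_le_eq)
  have "((\<lambda>h::complex. D * norm h) \<longlongrightarrow> D * norm (0::complex)) (at 0)" by (intro tendsto_intros)
  then have "((\<lambda>h. norm (?S (w + h) x - ?S w x - h *\<^sub>C (- ?S w (?S w x))) / norm h) \<longlongrightarrow> 0) (at 0)"
    using Lim_null_comparison[OF ev] by simp
  then have "((\<lambda>w. ?S w x) has_derivative (\<lambda>h. h *\<^sub>C (- ?S w (?S w x)))) (at w)"
    unfolding has_derivative_at using bounded_linear_scaleC_left by blast
  then show "\<exists>d. ((\<lambda>w. ?S w x) has_derivative (\<lambda>h. h *\<^sub>C d)) (at w)" by blast
qed

section \<open>The local spectrum and its radius\<close>

lemma cmod_local_spectrum_le:
  assumes T: "bounded_clinear_op T" and w: "w \<in> local_spectrum T x"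
  shows "cmod w \<le> onorm T"
proof (rule ccontr)
  assume "\<not> cmod w \<le> onorm T"
  then have "w \<in> local_resolvent T x"
    unfolding local_resolvent_def
    using resolvent_series_analytic[OF T, of x] resolvent_series_eq[OF T]
    by (auto intro!: exI[of _ "{w. cmod w > onorm T}"] exI[of _ "\<lambda>w. resolvent_series T w x"]
        simp: analytic_X_def)
  then show False using w by (simp add: local_spectrum_def)
qed

text \<open>Boundedness is what gives the real supremum in \<open>local_spectral_radius\<close> its
  intended meaning.\<close>

lemma bdd_above_local_spectrum:
  "bounded_clinear_op T \<Longrightarrow> bdd_above (cmod ` local_spectrum T x)"
  using cmod_local_spectrum_le by (intro bdd_aboveI2)

lemma local_spectral_radius_nonneg:
  assumes T: "bounded_clinear_op T"
  shows "local_spectral_radius T x \<ge> 0"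
proof (cases "local_spectrum T x = {}")
  case False
  then obtain w where "w \<in> local_spectrum T x" by blast
  then show ?thesis
    using cSUP_upper2[OF bdd_above_local_spectrum[OF T], of w x 0] False
    by (simp add: local_spectral_radius_def)
qed (simp add: local_spectral_radius_def)

lemma local_resolvent_outside:
  assumes T: "bounded_clinear_op T" and w: "cmod w > local_spectral_radius T x"
  shows "w \<in> local_resolvent T x"
proof (rule ccontr)
  assume "w \<notin> local_resolvent T x"
  then have *: "w \<in> local_spectrum T x" by (simp add: local_spectrum_def)
  then have "cmod w \<le> local_spectral_radius T x"
    using cSUP_upper[OF * bdd_above_local_spectrum[OF T]] by (auto simp: local_spectral_radius_def)
  then show False using w by simp
qed

text \<open>A local solution is chosen at each point of V. By SVEP the choices agree on overlaps, so
  the diagonal w \<mapsto> f w w coincides near each point with one analytic solution.\<close>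

lemma local_resolvent_function:
  assumes T: "bounded_clinear_op T" and svep: "SVEP T"
    and V: "open V" "V \<subseteq> local_resolvent T x"
  obtains u where "analytic_X u V" "\<And>z. z \<in> V \<Longrightarrow> z *\<^sub>C u z - T (u z) = x"
proof -
  have "\<forall>w. w \<in> V \<longrightarrow> (\<exists>U u. open U \<and> w \<in> U \<and> analytic_X u U \<and> (\<forall>z\<in>U. z *\<^sub>C u z - T (u z) = x))"
    using V(2) by (auto simp: local_resolvent_def)
  then obtain D f where Df: "\<And>w. w \<in> V \<Longrightarrow> open (D w)" "\<And>w. w \<in> V \<Longrightarrow> w \<in> D w"
    "\<And>w. w \<in> V \<Longrightarrow> analytic_X (f w) (D w)"
    "\<And>w z. w \<in> V \<Longrightarrow> z \<in> D w \<Longrightarrow> z *\<^sub>C f w z - T (f w z) = x"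
    by metis
  define u where "u w = f w w" for w
  have agree: "u z = f w z" if "w \<in> V" "z \<in> D w \<inter> V" for w z
    unfolding u_def by (rule SVEP_unique[OF T svep, of _ "D z" x _ "D w"]) (use that Df in auto)
  have "\<exists>d. (u has_derivative (\<lambda>h. h *\<^sub>C d)) (at w)" if w: "w \<in> V" for w
  proof -
    obtain d where d: "(f w has_derivative (\<lambda>h. h *\<^sub>C d)) (at w)"
      using Df(2,3)[OF w] unfolding analytic_X_def by blast
    have "(u has_derivative (\<lambda>h. h *\<^sub>C d)) (at w)"
      by (rule has_derivative_transform_within_open[OF d, of "D w \<inter> V"])
         (use w V Df agree[OF w] in auto)
    then show ?thesis by blast
  qed
  then have "analytic_X u V" using V by (simp add: analytic_X_def)
  moreover have "z *\<^sub>C u z - T (u z) = x" if "z \<in> V" for z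
    unfolding u_def using Df that by blast
  ultimately show ?thesis using that by blast
qed

text \<open>Uniqueness of Taylor coefficients. It transfers coefficients known from a small disc to
  the Taylor series on a larger one.\<close>

lemma deriv_at_0_of_sums:
  fixes h :: "complex \<Rightarrow> complex"
  assumes \<delta>: "\<delta> > 0" and s: "\<And>z. cmod z < \<delta> \<Longrightarrow> (\<lambda>n. b n * z ^ n) sums h z"
  shows "(deriv ^^ n) h 0 / fact n = b n"
proof -
  have "\<forall>\<^sub>F z in nhds 0. (\<lambda>n. fps_nth (Abs_fps b) n * z ^ n) sums h z"
    unfolding eventually_nhds_metric using \<delta> s by (auto intro!: exI[of _ \<delta>])
  then have "h has_fps_expansion Abs_fps b" by (rule has_fps_expansionI)
  from fps_nth_fps_expansion[OF this, of n] show ?thesis by simp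
qed

text \<open>In the variable 1/z the scalar local resolvent is holomorphic on the punctured disc of
  radius 1/r, and its expansion at 0 is the Neumann series. Its Taylor series therefore converges at
  1/R, where bounded terms give the estimate.\<close>

lemma local_spectral_radius_bound:
  fixes \<phi> :: "'a::complex_banach \<Rightarrow> complex"
  assumes T: "bounded_clinear_op T" and svep: "SVEP T"
    and \<phi>: "bounded_linear \<phi>" "\<And>c x. \<phi> (c *\<^sub>C x) = c * \<phi> x"
    and R: "R > local_spectral_radius T x"
  obtains M where "\<And>n. cmod (\<phi> ((T ^^ n) x)) \<le> M * R ^ n"
proof -
  define r where "r = (local_spectral_radius T x + R) / 2"
  have r: "r > local_spectral_radius T x" "r < R" "r > 0" "R > 0"
    using R local_spectral_radius_nonneg[OF T, of x] by (auto simp: r_def)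
  have K: "onorm T \<ge> 0" using T by (simp add: bounded_clinear_op_def onorm_pos_le)
  define V where "V = {w. cmod w > r}"
  have opV: "open V" unfolding V_def by (intro open_Collect_less continuous_intros)
  have "V \<subseteq> local_resolvent T x" using local_resolvent_outside[OF T] r by (auto simp: V_def)
  then obtain u where u: "analytic_X u V" "\<And>z. z \<in> V \<Longrightarrow> z *\<^sub>C u z - T (u z) = x"
    using local_resolvent_function[OF T svep opV] by blast
  have hol: "(\<lambda>z. \<phi> (u z)) holomorphic_on V"
    by (rule analytic_X_functional_holomorphic[OF \<phi> u(1)])
  \<comment> \<open>The value 0 at the origin is the limit of the resolvent at infinity.\<close>
  define h where "h z = (if z = 0 then 0 else \<phi> (u (inverse z)))" for z
  \<comment> \<open>The coefficients are shifted by one: \<open>\<phi> ((T ^^ m) x)\<close> belongs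
    to the power m + 1. This shift produces the extra factor R in the final constant.\<close>
  define b where "b n = (case n of 0 \<Rightarrow> 0 | Suc m \<Rightarrow> \<phi> ((T ^^ m) x))" for n
  \<comment> \<open>For 0 < |z| < \<delta> the point 1/z lies both in V and in the region of the
    Neumann series, where u must equal that series.\<close>
  define \<delta> where "\<delta> = inverse (max (onorm T) r + 1)"
  have pos: "max (onorm T) r + 1 > 0" using K by linarith
  have \<delta>: "\<delta> > 0" using pos by (simp add: \<delta>_def)
  have inv: "cmod (inverse z) > c" if "z \<noteq> 0" "cmod z < inverse c" "c > 0" for z c
    using that less_imp_inverse_less[of "cmod z" "inverse c"] by (simp add: norm_inverse)
  have sums: "(\<lambda>n. b n * z ^ n) sums h z" if z: "cmod z < \<delta>" for z
  proof (cases "z = 0")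
    case True
    then show ?thesis using powser_sums_zero[of b] by (simp add: h_def b_def)
  next
    case False
    have "cmod (inverse z) > max (onorm T) r + 1" using inv[OF False] z pos by (simp add: \<delta>_def)
    then have w: "cmod (inverse z) > onorm T" "inverse z \<in> V" by (auto simp: V_def)
    have "u (inverse z) = resolvent_series T (inverse z) x"
      by (rule resolvent_unique[OF T w(1) u(2)[OF w(2)]])
    then have "(\<lambda>n. z ^ Suc n *\<^sub>C (T ^^ n) x) sums u (inverse z)"
      using summable_resolvent_series[OF T w(1), of x] by (simp add: resolvent_series_def summable_sums)
    then have "(\<lambda>n. \<phi> (z ^ Suc n *\<^sub>C (T ^^ n) x)) sums \<phi> (u (inverse z))"
      by (rule bounded_linear.sums[OF \<phi>(1)])
    then have "(\<lambda>n. b (Suc n) * z ^ Suc n) sums h z"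
      using False by (simp add: \<phi>(2) b_def h_def mult.commute)
    then show ?thesis by (subst (asm) sums_Suc_iff) (simp add: b_def)
  qed
  have h1: "h holomorphic_on ball 0 \<delta>"
    by (rule power_series_holomorphic[where a = b]) (use sums in auto)
  have h2: "h holomorphic_on ball 0 (inverse r) - {0}"
  proof -
    have "((\<lambda>z. \<phi> (u z)) \<circ> inverse) holomorphic_on ball 0 (inverse r) - {0}"
    proof (rule holomorphic_on_compose_gen[OF _ hol])
      show "inverse holomorphic_on ball 0 (inverse r) - {0}" by (intro holomorphic_intros) auto
      show "inverse ` (ball 0 (inverse r) - {0}) \<subseteq> V" using inv r by (auto simp: V_def)
    qed
    then show ?thesis by (rule holomorphic_transform) (auto simp: h_def)
  qed
  have "h holomorphic_on ball 0 \<delta> \<union> (ball 0 (inverse r) - {0})"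
    by (rule holomorphic_on_Un[OF h1 h2]) auto
  then have hh: "h holomorphic_on ball 0 (inverse r)"
    by (rule holomorphic_on_subset) (use \<delta> in auto)
  have "inverse R < inverse r" using r by simp
  then have "complex_of_real (inverse R) \<in> ball 0 (inverse r)" using r by (simp add: norm_inverse)
  from holomorphic_power_series[OF hh this]
  have "summable (\<lambda>n. b n * of_real (inverse R) ^ n)"
    using deriv_at_0_of_sums[OF \<delta> sums] by (simp add: sums_iff)
  then have "Bseq (\<lambda>n. b n * of_real (inverse R) ^ n)"
    by (meson summable_LIMSEQ_zero convergentI convergent_imp_Bseq)
  then obtain M where M: "\<And>n. cmod (b n * of_real (inverse R) ^ n) \<le> M" by (auto simp: Bseq_def)
  have "cmod (\<phi> ((T ^^ n) x)) \<le> (M * R) * R ^ n" for n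
  proof -
    have "cmod (b (Suc n)) * inverse R ^ Suc n \<le> M"
      using M[of "Suc n"] r by (simp add: norm_mult norm_power norm_inverse)
    then have "cmod (b (Suc n)) \<le> M * R ^ Suc n"
      using r by (simp add: power_inverse field_simps)
    then show ?thesis by (simp add: b_def mult.assoc)
  qed
  then show ?thesis using that by blast
qed

section \<open>The estimate\<close>

text \<open>The terms are dominated by those of M exp (R |z|), which gives convergence everywhere
  and the growth bound together.\<close>

lemma power_series_exponential_type:
  fixes a :: "nat \<Rightarrow> complex"
  assumes a: "\<And>n. cmod (a n) \<le> M * R ^ n" and R: "R \<ge> 0"
  obtains f where "f holomorphic_on UNIV" "\<And>z. (\<lambda>n. a n / fact n * z ^ n) sums f z"
    "\<And>z. cmod (f z) \<le> M * exp (R * cmod z)" "deriv f 0 = a 1"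
proof -
  define f where "f z = (\<Sum>n. a n / fact n * z ^ n)" for z
  have e: "(\<lambda>n. M * ((R * cmod z) ^ n /\<^sub>R fact n)) sums (M * exp (R * cmod z))" for z
    using exp_converges by (rule sums_mult)
  have le: "cmod (a n / fact n * z ^ n) \<le> M * ((R * cmod z) ^ n /\<^sub>R fact n)" for n z
  proof -
    have "cmod (a n / fact n * z ^ n) = cmod (a n) * (cmod z ^ n / fact n)"
      by (simp add: norm_mult norm_divide norm_power)
    also have "\<dots> \<le> M * R ^ n * (cmod z ^ n / fact n)" using a[of n] by (intro mult_right_mono) auto
    finally show ?thesis by (simp add: power_mult_distrib field_simps)
  qed
  have s: "(\<lambda>n. a n / fact n * z ^ n) sums f z" for z
    unfolding f_def
    by (intro summable_sums summable_comparison_test'[OF sums_summable[OF e[of z]], of 0] le)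
  have growth: "cmod (f z) \<le> M * exp (R * cmod z)" for z
    using norm_suminf_le[OF le[of _ z] sums_summable[OF e[of z]]] sums_unique[OF e[of z]]
    by (simp add: f_def)
  have "f field_differentiable at z" for z
  proof -
    have "f holomorphic_on ball 0 (cmod z + 1)"
      by (rule power_series_holomorphic[where a = "\<lambda>n. a n / fact n"]) (use s in auto)
    then show ?thesis by (rule holomorphic_on_imp_differentiable_at) auto
  qed
  then have hol: "f holomorphic_on UNIV" by (simp add: holomorphic_on_def field_differentiable_at_within)
  have "deriv f 0 = a 1"
    using deriv_at_0_of_sums[of 1 "\<lambda>n. a n / fact n" f 1] s by simp
  then show ?thesis using that[of f] hol s growth by blast
qed

lemma summable_exp_op:
  assumes T: "bounded_clinear_op T"
  shows "summable (\<lambda>n. (t ^ n / fact n) *\<^sub>R (T ^^ n) x)"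
proof (rule summable_comparison_test'[where N = 0])
  show "summable (\<lambda>n. norm x * ((\<bar>t\<bar> * onorm T) ^ n /\<^sub>R fact n))"
    by (intro summable_mult summable_exp_generic)
  fix n
  have "norm ((t ^ n / fact n) *\<^sub>R (T ^^ n) x) \<le> \<bar>t\<bar> ^ n / fact n * (onorm T ^ n * norm x)"
    using norm_funpow_le[OF T, of n x] by (simp add: power_abs mult_left_mono divide_right_mono)
  also have "\<dots> = norm x * ((\<bar>t\<bar> * onorm T) ^ n /\<^sub>R fact n)"
    by (simp add: power_mult_distrib divide_inverse)
  finally show "norm ((t ^ n / fact n) *\<^sub>R (T ^^ n) x) \<le> norm x * ((\<bar>t\<bar> * onorm T) ^ n /\<^sub>R fact n)" .
qed

lemma norm_le_above_local_spectral_radius: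
  fixes T :: "'a::complex_banach \<Rightarrow> 'a"
  assumes \<alpha>: "0 \<le> \<alpha>" "\<alpha> < 1"
    and T: "bounded_clinear_op T" and svep: "SVEP T" and C: "C > 0"
    and growth: "\<And>t. norm (exp_op t T x) \<le> C * (1 + rpow \<bar>t\<bar> \<alpha>)"
    and \<sigma>: "\<sigma> > local_spectral_radius T x"
  shows "norm (T x) \<le> C * (\<sigma> + C_alpha \<alpha> * \<sigma> powr (1 - \<alpha>))"
proof -
  \<comment> \<open>The gap between R and \<sigma> is the room for the sinc multiplier; the gap
    between the local spectral radius and R yields the coefficient bound.\<close>
  obtain R where R: "local_spectral_radius T x < R" "R < \<sigma>" using dense[OF \<sigma>] by blast
  have R0: "R \<ge> 0" using R(1) local_spectral_radius_nonneg[OF T, of x] by simp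
  obtain \<phi> :: "'a \<Rightarrow> complex" where \<phi>: "bounded_linear \<phi>" "\<And>c x. \<phi> (c *\<^sub>C x) = c * \<phi> x"
    and \<phi>_le: "\<And>x. cmod (\<phi> x) \<le> norm x" and \<phi>_eq: "cmod (\<phi> (T x)) = norm (T x)"
    using complex_norming_functional[of "T x"] by blast
  obtain M where M: "\<And>n. cmod (\<phi> ((T ^^ n) x)) \<le> M * R ^ n"
    using local_spectral_radius_bound[OF T svep \<phi> R(1)] by blast
  obtain f where f: "f holomorphic_on UNIV" "\<And>z. (\<lambda>n. \<phi> ((T ^^ n) x) / fact n * z ^ n) sums f z"
    "\<And>z. cmod (f z) \<le> M * exp (R * cmod z)" "deriv f 0 = \<phi> ((T ^^ 1) x)"
    using power_series_exponential_type[OF M R0] by blast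
  have "f (of_real t) = \<phi> (exp_op t T x)" for t
  proof (rule sums_unique2[OF f(2)])
    have "(\<lambda>n. (t ^ n / fact n) *\<^sub>R (T ^^ n) x) sums exp_op t T x"
      unfolding exp_op_def using summable_exp_op[OF T] by (rule summable_sums)
    from bounded_linear.sums[OF \<phi>(1) this]
    show "(\<lambda>n. \<phi> ((T ^^ n) x) / fact n * of_real t ^ n) sums \<phi> (exp_op t T x)"
      by (simp add: linear_scale[OF bounded_linear.linear[OF \<phi>(1)]] scaleR_conv_of_real mult.commute)
  qed
  then have "cmod (f (of_real t)) \<le> C * (1 + rpow \<bar>t\<bar> \<alpha>)" for t
    using order_trans[OF \<phi>_le growth[of t]] by simp
  from bernstein_inequality_growth[OF f(1,3) R0 R(2) \<alpha> C this]
  show ?thesis by (simp add: f(4) \<phi>_eq)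
qed

theorem theorem2p11:
  fixes T :: "'a::complex_banach \<Rightarrow> 'a" and x :: 'a and \<alpha> Cx :: real
  assumes "0 \<le> \<alpha>" and "\<alpha> < 1"
    and "bounded_clinear_op T" and "SVEP T"
    and "Cx > 0"
    and "\<forall>t::real. norm (exp_op t T x) \<le> Cx * (1 + rpow \<bar>t\<bar> \<alpha>)"
  shows "norm (T x) \<le> Cx * (local_spectral_radius T x
            + C_alpha \<alpha> * local_spectral_radius T x powr (1 - \<alpha>))"
proof (rule tendsto_lowerbound)
  let ?r = "local_spectral_radius T x"
  \<comment> \<open>The radius may be 0, where the limit from the right still holds because the
    exponent 1 - \<alpha> is positive and 0 powr (1 - \<alpha>) = 0.\<close>
  have lim: "((\<lambda>\<sigma>. \<sigma> powr (1 - \<alpha>)) \<longlongrightarrow> ?r powr (1 - \<alpha>)) (at_right ?r)"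
  proof (rule tendsto_powr2[OF tendsto_ident_at tendsto_const])
    show "\<forall>\<^sub>F \<sigma> in at_right ?r. 0 \<le> \<sigma>"
      using eventually_at_right_less[of ?r]
      by eventually_elim (use local_spectral_radius_nonneg[OF assms(3), of x] in linarith)
  qed (use assms in simp)
  show "((\<lambda>\<sigma>. Cx * (\<sigma> + C_alpha \<alpha> * \<sigma> powr (1 - \<alpha>)))
      \<longlongrightarrow> Cx * (?r + C_alpha \<alpha> * ?r powr (1 - \<alpha>))) (at_right ?r)"
    by (intro tendsto_mult tendsto_add tendsto_const tendsto_ident_at lim)
  show "\<forall>\<^sub>F \<sigma> in at_right ?r. norm (T x) \<le> Cx * (\<sigma> + C_alpha \<alpha> * \<sigma> powr (1 - \<alpha>))"
    using eventually_at_right_less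
    by eventually_elim (rule norm_le_above_local_spectral_radius; use assms in simp)
qed simp

end
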